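(* Let $r\in\mathbb{Q}\setminus\{0,1,-1\}$ and let $S$ be a set of rational primes such that $|r|_p=1$ for every rational prime $p\notin S$. Suppose that the set of rational primes not in $S$, written $\{p_1<p_2<\cdots\}$, is infinite and satisfies \[ \frac{\log(p_{n+1})}{p_n}\longrightarrow\infty\quad\text{as } n\to\infty . \] Then $F_S$ admits some circle $|z|=R$ of radius $R\leqslant 1$ as its natural boundary.
   Context: For a set $S$ of rational primes and $x\in\mathbb{Q}$, $|x|_S=\prod_{p\in S}|x|_p$ with $|\cdot|_p$ the usual $p$-adic absolute value; $|\cdot|$ is the usual real absolute value. Define $f_S(n)=|r^n-1|\cdot|r^n-1|_S$ for $n\geqslant 1$ and $F_S(z)=\sum_{n\geqslant 1}f_S(n)z^n$. A circle $|z|=R$ (with $R>0$) is a natural boundary for a power series if it is the circle of convergence and the series has no analytic continuation to any connected open set properly containing the open disc $|z|<R$ (equivalently, every point of the circle is a singularity). *)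

theory Defs
  imports "HOL-Complex_Analysis.Complex_Analysis" "HOL-Computational_Algebra.Computational_Algebra"
    "HOL-Library.Infinite_Set"
begin

definition padic_abs :: "nat \<Rightarrow> rat \<Rightarrow> real" where
  "padic_abs p x = (if x = 0 then 0 else
     real p powi (int (multiplicity (int p) (snd (quotient_of x)))
                - int (multiplicity (int p) (fst (quotient_of x)))))"

text \<open>
  The product over a possibly infinite set \<open>S\<close> is the limit of its partial products
  over \<open>p \<le> N\<close>. For \<open>x \<noteq> 0\<close> all but finitely many factors are 1, so the partial products
  are eventually constant.
\<close>
definition S_abs :: "nat set \<Rightarrow> rat \<Rightarrow> real" where
  "S_abs S x = lim (\<lambda>N. \<Prod>p\<in>{p \<in> S. p \<le> N}. padic_abs p x)"

definition f_S :: "rat \<Rightarrow> nat set \<Rightarrow> nat \<Rightarrow> real" where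
  "f_S r S n = real_of_rat \<bar>r ^ n - 1\<bar> * S_abs S (r ^ n - 1)"

definition F_S :: "rat \<Rightarrow> nat set \<Rightarrow> complex fps" where
  "F_S r S = Abs_fps (\<lambda>n. if n = 0 then 0 else of_real (f_S r S n))"

definition natural_boundary :: "complex fps \<Rightarrow> real \<Rightarrow> bool" where
  "natural_boundary F R \<longleftrightarrow>
     R > 0 \<and> fps_conv_radius F = ereal R \<and>
     \<not> (\<exists>U g. open U \<and> connected U \<and> ball 0 R \<subset> U \<and> g holomorphic_on U \<and>
           (\<forall>z\<in>ball 0 R. g z = eval_fps F z))"

end

(*
  Write r = a/b. By the product formula f_S n is the part of a^n - b^n composed of the primes
  p_1 < p_2 < ... outside S, hence a positive integer; p_k contributes exactly when the order m_k
  of a/b modulo p_k divides n, and m_k < p_k while m_{k+1} / p_k tends to infinity.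

  One estimate handles every radius. Suppose that sum b_i z^i, of radius at least 1, continues
  analytically across a point w of the unit circle. Pushing the Cauchy contour out of the disc
  near w gives a monic polynomial T such that the functional z^i |-> b_i is exponentially small on
  the powers of T.

  If R = 1 and the b_i are integers, the Hankel determinants det (b_{i+j}), computed in the basis
  z^l T^k, tend to 0, so they vanish eventually and b satisfies a linear recurrence
  (Polya-Carlson). But f_S repeats every initial window f_S 1, ..., f_S K right after some n at
  which f_S n is arbitrarily large.

  If R < 1, the n with f_S n >= c^n, for a fixed c in (1, 1/R), are multiples j m_k with j
  bounded, hence Hadamard lacunary. Since T can be chosen with T = z^d + (terms of degree close to
  d), the functional evaluated at z^l T^k is a single coefficient of the lacunary part, which is
  therefore exponentially small (Hadamard's gap theorem), contradicting the radius of convergence.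
*)
theory Submission
  imports Defs "HOL-Number_Theory.Number_Theory" "Jordan_Normal_Form.Determinant"
begin

hide_const (open) up_ring.coeff up_ring.monom Module.smult

section \<open>Series continuing across a point of the unit circle\<close>

text \<open>Growth of the periods: with m the period of p, the prime p divides the nonzero number
  a^m - b^m, which is at most H^m for H = |a| + |b|. Hence m_{k+1} >= log p_{k+1} / log H outgrows
  every multiple of p_k, and p_k exceeds m_k. All primes before p_k add up to at most m_k + O(1), so
  the last prime whose period divides n controls f_S n.

  T exists because the contour lies outside the open unit disc and misses w: its image under z ->
  1/z is a compact part of the closed disc that omits a point of the circle, hence has capacity
  below 1. That T is monic matters twice: it makes the change of basis unimodular, and it isolates a
  single top coefficient.

  The obstacle is that the continuation is known on the circle only near w, so the contour has to be
  shrunk by \<rho> < 1. The limiting contour and T are therefore fixed first and \<rho> afterwards,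
  close enough to 1 to keep T small.

  The recurrence is refuted without passing to rational functions: read backwards, it determines a
  coefficient from those that follow it, while the same following window occurs after arbitrarily
  large coefficients.\<close>

text \<open>For b the coefficients of g this is the contour integral of g(z) h(1/z) / (2 \<pi> i z)
  around 0. A bound for h(1/z) on any admissible contour therefore bounds it.\<close>

definition coeff_functional :: "(nat \<Rightarrow> complex) \<Rightarrow> complex poly \<Rightarrow> complex" where
  "coeff_functional b h = (\<Sum>i\<le>degree h. coeff h i * b i)"

section \<open>Pushing a Cauchy contour across the unit circle\<close>

text \<open>Lets the circle start at angle a, where the arc to be replaced ends, so that this arc
  becomes the final piece of the parameter interval and is not split by the base point.\<close>

lemma has_contour_integral_part_circlepath_rotate:
  "(f has_contour_integral I) (part_circlepath 0 \<rho> a (a + 2 * pi)) \<longleftrightarrow>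
   ((\<lambda>z. f (cis a * z) * cis a) has_contour_integral I) (circlepath 0 \<rho>)"
proof -
  have "linepath a (a + pi * 2) x = a + x * (pi * 2)" for x
    by (simp add: linepath_def algebra_simps)
  then have eq: "exp (\<i> * complex_of_real (linepath a (a + pi * 2) x)) =
      cis a * exp (\<i> * (complex_of_real x * (complex_of_real pi * 2)))" for x
    by (simp add: cis_conv_exp exp_add[symmetric] distrib_left)
  show ?thesis
    unfolding has_contour_integral_def circlepath_def
    by (rule has_integral_cong)
       (simp add: vector_derivative_part_circlepath01, simp add: part_circlepath_def eq mult_ac
          flip: linepath_of_real)
qed

lemma contour_integral_part_circlepath_combine:
  assumes "a < m" "m < c" "continuous_on (path_image (part_circlepath 0 \<rho> a c)) f"
  shows "contour_integral (part_circlepath 0 \<rho> a c) f =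
         contour_integral (part_circlepath 0 \<rho> a m) f + contour_integral (part_circlepath 0 \<rho> m c) f"
proof -
  have "f contour_integrable_on part_circlepath 0 \<rho> a c"
    using assms(3) by (rule contour_integrable_continuous_part_circlepath)
  then have "(\<lambda>t. f (0 + complex_of_real \<rho> * cis t) * complex_of_real \<rho> * \<i> * cis t) integrable_on {a..c}"
    using assms contour_integrable_part_circlepath_iff[of a c f 0 \<rho>] by simp
  from Henstock_Kurzweil_Integration.integral_combine[OF _ _ this, of m] assms
  show ?thesis by (simp add: contour_integral_part_circlepath_eq)
qed

text \<open>The integrand is written with \<open>(1 / z) ^ i / z\<close> so that summing against the
  coefficients of h produces \<open>g z * poly h (1 / z) / z\<close>.\<close>

lemma cauchy_coefficient_rotated:
  assumes "fps_conv_radius B \<ge> 1" "\<And>z. z \<in> ball 0 1 \<Longrightarrow> g z = eval_fps B z" "0 < \<rho>" "\<rho> < 1"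
  shows "((\<lambda>z. g z * (1 / z) ^ i / z) has_contour_integral 2 * pi * \<i> * fps_nth B i)
           (part_circlepath 0 \<rho> a (a + 2 * pi))"
proof -
  define G where "G z = g (cis a * z)" for z
  have "ball 0 1 \<subseteq> eball 0 (fps_conv_radius B)"
    using assms(1) by (auto simp: eball_def one_ereal_def intro: less_le_trans[of _ "ereal 1"])
  then have holB: "eval_fps B holomorphic_on ball 0 1"
    by (rule holomorphic_on_eval_fps)
  have holg: "g holomorphic_on ball 0 1"
    by (rule holomorphic_transform[OF holB]) (use assms(2) in auto)
  have holG: "G holomorphic_on ball 0 1"
  proof -
    have "(\<lambda>z. cis a * z) ` ball 0 1 \<subseteq> ball 0 1"
      by (auto simp: norm_mult)
    then have "(g \<circ> (\<lambda>z. cis a * z)) holomorphic_on ball 0 1"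
      by (intro holomorphic_on_compose_gen[OF _ holg] holomorphic_intros) 
    then show ?thesis by (simp add: G_def[abs_def] o_def)
  qed
  have "(deriv ^^ i) G 0 = cis a ^ i * (deriv ^^ i) g 0"
  proof -
    have "(deriv ^^ i) (\<lambda>w. g (cis a * w)) 0 = cis a ^ i * (deriv ^^ i) g (cis a * 0)"
      by (rule higher_deriv_compose_linear[OF holg, of "ball 0 1"]) (auto simp: norm_mult)
    then show ?thesis by (simp add: G_def[abs_def])
  qed
  also have "(deriv ^^ i) g 0 = (deriv ^^ i) (eval_fps B) 0"
    by (rule higher_deriv_transform_within_open[of _ "ball 0 1"]) (use holg holB assms(2) in auto)
  also have "\<dots> = fact i * fps_nth B i"
    using fps_nth_conv_deriv[of B i] order.strict_trans2[OF _ assms(1), of 0] by simp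
  finally have d: "(deriv ^^ i) G 0 = cis a ^ i * (fact i * fps_nth B i)" .
  have "((\<lambda>u. G u / (u - 0) ^ Suc i) has_contour_integral
          ((2 * pi * \<i>) / fact i * (deriv ^^ i) G 0)) (circlepath 0 \<rho>)"
    by (rule Cauchy_has_contour_integral_higher_derivative_circlepath)
       (use assms holG in \<open>auto intro!: holomorphic_on_imp_continuous_on intro: holomorphic_on_subset\<close>)
  \<comment> \<open>The factor \<open>cis (-a) ^ i\<close> undoes the factor
    \<open>cis a ^ i\<close> that the rotation puts into the i-th derivative.\<close>
  then have "((\<lambda>u. cis (-a) ^ i * (G u / u ^ Suc i)) has_contour_integral
          (cis (-a) ^ i * (2 * pi * \<i> / fact i * (deriv ^^ i) G 0))) (circlepath 0 \<rho>)"
    by (intro has_contour_integral_lmul) simp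
  also have "cis (-a) ^ i * (2 * pi * \<i> / fact i * (deriv ^^ i) G 0) = 2 * pi * \<i> * fps_nth B i"
    by (simp add: d flip: mult.assoc power_mult_distrib) (simp add: cis_mult)
  also have "(\<lambda>u. cis (-a) ^ i * (G u / u ^ Suc i)) =
      (\<lambda>z. g (cis a * z) * (1 / (cis a * z)) ^ i / (cis a * z) * cis a)"
    by (rule ext) (simp add: G_def power_mult_distrib power_divide field_simps cis_mult
        flip: cis_inverse)
  finally show ?thesis
    by (simp add: has_contour_integral_part_circlepath_rotate)
qed

lemma in_scaled_segment:
  fixes \<rho> :: real and p q z :: complex
  assumes "z \<in> closed_segment (complex_of_real \<rho> * p) (complex_of_real \<rho> * q)"
  obtains w where "w \<in> closed_segment p q" "z = complex_of_real \<rho> * w"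
proof -
  from assms obtain u where u: "0 \<le> u" "u \<le> 1" "z = (1 - u) *\<^sub>R (\<rho> * p) + u *\<^sub>R (\<rho> * q)"
    by (auto simp: in_segment)
  have "(1 - u) *\<^sub>R p + u *\<^sub>R q \<in> closed_segment p q"
    using u by (auto simp: in_segment)
  moreover have "z = \<rho> * ((1 - u) *\<^sub>R p + u *\<^sub>R q)"
    using u(3) by (simp add: algebra_simps scaleR_conv_of_real)
  ultimately show ?thesis by (rule that)
qed

lemma cis_near:
  fixes s t :: real
  shows "norm (cis s - cis t) \<le> \<bar>s - t\<bar>"
proof -
  have "norm (cis s - cis t) = norm (exp (\<i> * s) - exp (\<i> * t))"
    by (simp add: cis_conv_exp)
  also have "\<dots> = 2 * \<bar>sin ((s - t) / 2)\<bar>"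
    using dist_exp_i_1[of "s - t"] 
    by (metis (no_types, lifting) cis_conv_exp cis_divide cis_neq_zero diff_divide_distrib divide_self norm_cis norm_divide div_by_1)
  also have "\<dots> \<le> 2 * \<bar>(s - t) / 2\<bar>"
    by (intro mult_left_mono abs_sin_x_le_abs_x) auto
  finally show ?thesis by simp
qed

text \<open>Each segment lies on the tangent line at \<open>cis (\<alpha> + t)\<close> with t =
  \<phi> or t = -\<phi>. Rotating that tangent point to 1 turns the line into Re = 1. This form
  gives both norm at least 1 and the avoidance of \<open>cis \<alpha>\<close>, for which the real
  part is cos \<phi> < 1.\<close>

lemma tangent_segment:
  assumes "cos \<phi> \<noteq> 0" "z \<in> closed_segment (cis (\<alpha> - \<phi>)) (complex_of_real (1 / cos \<phi>) * cis \<alpha>) \<union>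
      closed_segment (complex_of_real (1 / cos \<phi>) * cis \<alpha>) (cis (\<alpha> + \<phi>))"
  shows "Re (z * cis (\<phi> - \<alpha>)) = 1 \<or> Re (z * cis (- \<phi> - \<alpha>)) = 1"
proof -
  have ex: "\<exists>u. z = (1 - u) *\<^sub>R cis (\<alpha> + t) + u *\<^sub>R (complex_of_real (1 / cos \<phi>) * cis \<alpha>) \<and> (t = \<phi> \<or> t = - \<phi>)" if "t = \<phi> \<or> t = - \<phi>" "z \<in> closed_segment (cis (\<alpha> + t)) (complex_of_real (1 / cos \<phi>) * cis \<alpha>)" for t
    using that by (auto simp: in_segment simp del: of_real_divide)
  have "\<exists>u t. z = (1 - u) *\<^sub>R cis (\<alpha> + t) + u *\<^sub>R (complex_of_real (1 / cos \<phi>) * cis \<alpha>) \<and> (t = \<phi> \<or> t = - \<phi>)"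
    using assms(2)
  proof
    assume "z \<in> closed_segment (cis (\<alpha> - \<phi>)) (complex_of_real (1 / cos \<phi>) * cis \<alpha>)"
    then have "z \<in> closed_segment (cis (\<alpha> + - \<phi>)) (complex_of_real (1 / cos \<phi>) * cis \<alpha>)" by simp
    with ex[of "- \<phi>"] show ?thesis by blast
  next
    assume "z \<in> closed_segment (complex_of_real (1 / cos \<phi>) * cis \<alpha>) (cis (\<alpha> + \<phi>))"
    then show ?thesis using ex[of \<phi>] by (simp add: closed_segment_commute) blast
  qed
  then obtain u t where t: "t = \<phi> \<or> t = - \<phi>"
      and z: "z = (1 - u) *\<^sub>R cis (\<alpha> + t) + u *\<^sub>R (complex_of_real (1 / cos \<phi>) * cis \<alpha>)"
    by blast
  have "z * cis (- t - \<alpha>) = (1 - u) *\<^sub>R 1 + u *\<^sub>R ((1 / cos \<phi>) * cis (- t))"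
    by (simp add: z distrib_right cis_mult mult.assoc scaleR_conv_of_real)
  then have "Re (z * cis (- t - \<alpha>)) = 1"
    using t assms(1) by auto
  then show ?thesis using t by auto
qed

(*
  The contour \<Gamma> is the unit circle with the arc of half-angle \<phi> around cis \<alpha> replaced by the
  two tangent segments meeting at cis \<alpha> / cos \<phi>. It is shrunk by a factor \<rho> < 1 because g need not
  be defined on the unit circle away from cis \<alpha>.
*)
lemma coeff_functional_contour_bound:
  fixes B :: "complex fps"
  assumes U: "open U" "cis \<alpha> \<in> U" "ball 0 1 \<subseteq> U" "g holomorphic_on U"
    and B: "fps_conv_radius B \<ge> 1" "\<And>z. z \<in> ball 0 1 \<Longrightarrow> g z = eval_fps B z"
  obtains \<Gamma> \<rho>0 where "compact \<Gamma>" "\<And>z. z \<in> \<Gamma> \<Longrightarrow> norm z \<ge> 1" "cis \<alpha> \<notin> \<Gamma>" "\<rho>0 < 1"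
    "\<And>\<rho>. \<rho>0 < \<rho> \<Longrightarrow> \<rho> < 1 \<Longrightarrow> \<exists>C\<ge>0. \<forall>h M. (\<forall>z\<in>\<Gamma>. norm (poly h (1 / (of_real \<rho> * z))) \<le> M) \<longrightarrow>
       norm (coeff_functional (fps_nth B) h) \<le> C * M"
proof -
  obtain \<epsilon>' where "\<epsilon>' > 0" "ball (cis \<alpha>) \<epsilon>' \<subseteq> U"
    using U by (auto simp: open_contains_ball)
  \<comment> \<open>The cap 1/2 keeps the disc around \<open>cis \<alpha>\<close> away from 0, where
    the integrand may be singular.\<close>
  define \<epsilon> where "\<epsilon> = min \<epsilon>' (1/2)"
  have \<epsilon>: "\<epsilon> > 0" "\<epsilon> \<le> 1/2" "ball (cis \<alpha>) \<epsilon> \<subseteq> U"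
    using \<open>\<epsilon>' > 0\<close> \<open>ball (cis \<alpha>) \<epsilon>' \<subseteq> U\<close> by (auto simp: \<epsilon>_def)
  have "eventually (\<lambda>\<phi>::real. \<phi> < \<epsilon> / 4) (at_right 0)" "eventually (\<lambda>\<phi>::real. \<phi> < pi / 4) (at_right 0)"
    "eventually (\<lambda>\<phi>::real. \<phi> > 0) (at_right 0)"
    using \<epsilon>(1) by (auto simp: eventually_at_right_less intro!: order_tendstoD(2)[OF tendsto_ident_at]
       simp del: less_divide_eq_numeral1)
  moreover have "((\<lambda>\<phi>. 1 / cos \<phi>) \<longlongrightarrow> 1 / cos (0::real)) (at_right 0)"
    by (intro tendsto_intros) auto
  then have "eventually (\<lambda>\<phi>::real. 1 / cos \<phi> < 1 + \<epsilon> / 4) (at_right 0)"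
    using \<epsilon>(1) by (intro order_tendstoD(2)) auto
  ultimately have "eventually (\<lambda>\<phi>::real. \<phi> < \<epsilon> / 4 \<and> \<phi> < pi / 4 \<and> \<phi> > 0 \<and> 1 / cos \<phi> < 1 + \<epsilon> / 4) (at_right 0)"
    by eventually_elim auto
  then obtain \<phi> :: real where \<phi>: "\<phi> < \<epsilon> / 4" "\<phi> < pi / 4" "\<phi> > 0" "1 / cos \<phi> < 1 + \<epsilon> / 4"
    by (auto dest!: eventually_happens simp: trivial_limit_at_right_real)
  have cos\<phi>: "0 < cos \<phi>" "cos \<phi> < 1"
    using \<phi> cos_gt_zero[of \<phi>] cos_monotone_0_pi[of 0 \<phi>] by auto
  define p q m where "p = cis (\<alpha> - \<phi>)" and "q = cis (\<alpha> + \<phi>)" and "m = complex_of_real (1 / cos \<phi>) * cis \<alpha>"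
  \<comment> \<open>The angles from a to b trace the long arc that is kept; those from b to c trace,
    after a full turn, the short arc around \<open>cis \<alpha>\<close>.\<close>
  define a b c where "a = \<alpha> + \<phi>" and "b = \<alpha> - \<phi> + 2 * pi" and "c = a + 2 * pi"
  have abc: "a < b" "b < c" using \<phi> pi_gt_zero by (auto simp: a_def b_def c_def)
  define A1 where "A1 = path_image (part_circlepath 0 1 a b)"
  define A2 where "A2 = closed_segment p m \<union> closed_segment m q"
  define \<Gamma> where "\<Gamma> = A1 \<union> A2"
  have A1: "A1 = {cis x | x. a \<le> x \<and> x \<le> b}"
    using abc by (auto simp: A1_def path_image_part_circlepath cis_conv_exp)
  have re: "Re (z * cis (\<phi> - \<alpha>)) = 1 \<or> Re (z * cis (- \<phi> - \<alpha>)) = 1" if "z \<in> A2" for z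
    using tangent_segment[of \<phi> z \<alpha>] that cos\<phi> by (simp add: A2_def p_def q_def m_def)
  have "compact \<Gamma>"
    unfolding \<Gamma>_def A1_def A2_def by (intro compact_Un compact_path_image) auto
  moreover have "norm z \<ge> 1" if "z \<in> \<Gamma>" for z
  proof (cases "z \<in> A1")
    case False
    then have "z \<in> A2" using that by (auto simp: \<Gamma>_def)
    from re[OF this] show ?thesis
      using complex_Re_le_cmod[of "z * cis (\<phi> - \<alpha>)"] complex_Re_le_cmod[of "z * cis (- \<phi> - \<alpha>)"]
      by (auto simp: norm_mult)
  qed (auto simp: A1)
  moreover have "cis \<alpha> \<notin> \<Gamma>"
  proof
    assume "cis \<alpha> \<in> \<Gamma>"
    then consider "cis \<alpha> \<in> A1" | "cis \<alpha> \<in> A2" by (auto simp: \<Gamma>_def)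
    then show False
    proof cases
      case 1
      then obtain x where x: "cis \<alpha> = cis x" "a \<le> x" "x \<le> b" by (auto simp: A1)
      then have "cis (x - \<alpha>) = 1" by (simp flip: cis_divide)
      then have c1: "cos (x - \<alpha>) = 1" by (metis cis.simps(1) one_complex.simps(1))
      have "cos (x - \<alpha>) \<le> cos \<phi>"
      proof (cases "x - \<alpha> \<le> pi")
        case True
        then show ?thesis using x \<phi> by (intro cos_monotone_0_pi_le) (auto simp: a_def)
      next
        case False
        have "cos (2 * pi - (x - \<alpha>)) \<le> cos \<phi>"
          using x \<phi> False by (intro cos_monotone_0_pi_le) (auto simp: b_def)
        then show ?thesis by (simp add: cos_diff)
      qed
      then show False using c1 cos\<phi> by simp
    next
      case 2
      from re[OF this] show False using cos\<phi> by (auto simp: cis_mult)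
    qed
  qed
  moreover
  \<comment> \<open>Shrinking by \<rho> > \<rho>0 moves a point by less than \<epsilon>/4 beyond the
    contraction towards \<open>cis \<alpha>\<close>, so points within \<epsilon>/2 of
    \<open>cis \<alpha>\<close> stay in the \<epsilon>-disc.\<close>
  define \<rho>0 where "\<rho>0 = 1 - \<epsilon> / 4"
  have "\<rho>0 < 1" using \<epsilon> by (simp add: \<rho>0_def)
  moreover have "\<exists>C\<ge>0. \<forall>h M. (\<forall>z\<in>\<Gamma>. norm (poly h (1 / (of_real \<rho> * z))) \<le> M) \<longrightarrow>
       norm (coeff_functional (fps_nth B) h) \<le> C * M" if \<rho>: "\<rho>0 < \<rho>" "\<rho> < 1" for \<rho>
  proof -
    have \<rho>pos: "0 < \<rho>" using \<rho> \<epsilon> by (auto simp: \<rho>0_def)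
    define V where "V = ball (cis \<alpha>) \<epsilon>"
    have scaleV: "of_real \<rho> * z \<in> V" if "norm (z - cis \<alpha>) < \<epsilon> / 2" for z
    proof -
      have "norm (of_real \<rho> * z - cis \<alpha>) = norm (of_real \<rho> * (z - cis \<alpha>) - of_real (1 - \<rho>) * cis \<alpha>)"
        by (simp add: algebra_simps)
      also have "\<dots> \<le> \<rho> * norm (z - cis \<alpha>) + (1 - \<rho>)"
        using norm_triangle_ineq4[of "of_real \<rho> * (z - cis \<alpha>)" "of_real (1 - \<rho>) * cis \<alpha>"] \<rho> \<rho>pos
        by (simp only: norm_mult norm_of_real norm_cis) auto
      also have "\<dots> \<le> 1 * norm (z - cis \<alpha>) + (1 - \<rho>)"
        using \<rho> by (intro add_right_mono mult_right_mono) auto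
      also have "\<dots> < \<epsilon>" using that \<rho> \<epsilon> by (simp add: \<rho>0_def)
      finally show ?thesis by (simp add: V_def dist_norm norm_minus_commute)
    qed
    have "norm (p - cis \<alpha>) < \<epsilon> / 2" "norm (q - cis \<alpha>) < \<epsilon> / 2"
      using cis_near[of "\<alpha> - \<phi>" \<alpha>] cis_near[of "\<alpha> + \<phi>" \<alpha>] \<phi> by (auto simp: p_def q_def)
    moreover have "norm (m - cis \<alpha>) < \<epsilon> / 2"
    proof -
      have "m - cis \<alpha> = of_real (1 / cos \<phi> - 1) * cis \<alpha>"
        by (simp add: m_def algebra_simps)
      then have "norm (m - cis \<alpha>) = \<bar>1 / cos \<phi> - 1\<bar>"
        by (simp only: norm_mult norm_of_real norm_cis mult_1_right)
      moreover have "1 / cos \<phi> > 1" using cos\<phi> by (simp add: field_simps)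
      ultimately show ?thesis using \<phi>(4) \<epsilon> by simp
    qed
    ultimately have pqmV: "\<rho> * p \<in> V" "\<rho> * q \<in> V" "\<rho> * m \<in> V"
      using scaleV by auto
    have "convex V" "open V" by (auto simp: V_def)
    have V0: "0 \<notin> V" using \<epsilon> by (auto simp: V_def)
    have segV: "closed_segment (\<rho> * p) (\<rho> * m) \<subseteq> V" "closed_segment (\<rho> * m) (\<rho> * q) \<subseteq> V"
      using pqmV \<open>convex V\<close> by (auto simp: closed_segment_subset)
    define P1 where "P1 = part_circlepath 0 \<rho> a b"
    define P2 where "P2 = part_circlepath 0 \<rho> b c"
    define S where "S = path_image P1 \<union> closed_segment (\<rho> * p) (\<rho> * m) \<union> closed_segment (\<rho> * m) (\<rho> * q)"
    have S_scaled: "\<exists>w\<in>\<Gamma>. z = of_real \<rho> * w" if "z \<in> S" for z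
    proof -
      from that consider "z \<in> path_image P1" | "z \<in> closed_segment (\<rho> * p) (\<rho> * m)" | "z \<in> closed_segment (\<rho> * m) (\<rho> * q)"
        by (auto simp: S_def)
      then show ?thesis
      proof cases
        case 1
        then show ?thesis using abc by (auto simp: P1_def path_image_part_circlepath \<Gamma>_def A1 cis_conv_exp)
      qed (auto simp: \<Gamma>_def A2_def elim!: in_scaled_segment)
    qed
    have P1ball: "path_image P1 \<subseteq> ball 0 1 - {0}"
      using abc \<rho> \<rho>pos by (auto simp: P1_def path_image_part_circlepath norm_mult)
    have S_sub: "S \<subseteq> U - {0}"
      using P1ball U(3) segV V0 \<epsilon>(3) by (auto simp: S_def V_def)
    have S_compact: "compact S"
      unfolding S_def P1_def by (intro compact_Un compact_path_image) auto
    have "continuous_on S (\<lambda>z. g z / z)"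
      using S_sub by (intro continuous_intros continuous_on_subset[OF holomorphic_on_imp_continuous_on[OF U(4)]]) auto
    then have "bounded ((\<lambda>z. g z / z) ` S)"
      using S_compact compact_continuous_image compact_imp_bounded by blast
    then obtain A where A: "A > 0" "\<And>z. z \<in> S \<Longrightarrow> norm (g z / z) \<le> A"
      by (auto simp: bounded_pos)
    define L where "L = \<rho> * (b - a) + norm (\<rho> * m - \<rho> * p) + norm (\<rho> * q - \<rho> * m)"
    have "L \<ge> 0" using \<rho>pos abc by (auto simp: L_def)
    have P2V: "path_image P2 \<subseteq> V"
    proof
      fix z assume "z \<in> path_image P2"
      then obtain x where x: "z = \<rho> * cis x" "b \<le> x" "x \<le> c"
        using abc by (auto simp: P2_def path_image_part_circlepath cis_conv_exp)
      have "norm (cis x - cis \<alpha>) = norm (cis (x - 2 * pi) - cis \<alpha>)"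
        by (simp flip: cis_divide)
      also have "\<dots> \<le> \<bar>(x - 2 * pi) - \<alpha>\<bar>" by (rule cis_near)
      also have "\<dots> \<le> \<phi>" using x by (auto simp: a_def b_def c_def)
      finally show "z \<in> V" using \<phi> \<epsilon> scaleV x by auto
    qed
    have ends: "pathstart P2 = \<rho> * p" "pathfinish P2 = \<rho> * q"
    proof -
      have "pathstart P2 = \<rho> * cis b" "pathfinish P2 = \<rho> * cis c"
        by (simp_all add: P2_def cis_conv_exp)
      then show "pathstart P2 = \<rho> * p" "pathfinish P2 = \<rho> * q"
        by (simp_all add: a_def b_def c_def p_def q_def flip: cis_mult)
    qed
    have main: "norm (coeff_functional (fps_nth B) h) \<le> A * L / (2 * pi) * M"
      if M: "\<forall>z\<in>\<Gamma>. norm (poly h (1 / (of_real \<rho> * z))) \<le> M" for h M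
    proof -
      define f where "f z = g z * poly h (1 / z) / z" for z
      have holf: "f holomorphic_on U - {0}"
        unfolding f_def poly_altdef
        by (intro holomorphic_intros holomorphic_on_subset[OF U(4)]) auto
      have "((\<lambda>z. \<Sum>i\<le>degree h. coeff h i * (g z * (1 / z) ^ i / z)) has_contour_integral
         (\<Sum>i\<le>degree h. coeff h i * (2 * pi * \<i> * fps_nth B i))) (part_circlepath 0 \<rho> a (a + 2 * pi))"
        by (intro has_contour_integral_sum has_contour_integral_lmul cauchy_coefficient_rotated B \<rho> \<rho>pos) auto
      also have "(\<lambda>z. \<Sum>i\<le>degree h. coeff h i * (g z * (1 / z) ^ i / z)) = f"
        by (simp add: f_def poly_altdef sum_distrib_left sum_divide_distrib mult_ac fun_eq_iff)
      also have "(\<Sum>i\<le>degree h. coeff h i * (2 * pi * \<i> * fps_nth B i)) =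
          2 * pi * \<i> * coeff_functional (fps_nth B) h"
        by (simp add: coeff_functional_def sum_distrib_left mult_ac)
      finally have "2 * pi * \<i> * coeff_functional (fps_nth B) h = contour_integral (part_circlepath 0 \<rho> a c) f"
        by (simp add: c_def contour_integral_unique)
      also have "\<dots> = contour_integral P1 f + contour_integral P2 f"
        unfolding P1_def P2_def
      proof (rule contour_integral_part_circlepath_combine[OF abc])
        have "path_image (part_circlepath 0 \<rho> a c) \<subseteq> U - {0}"
          using abc \<rho> \<rho>pos U(3) by (auto simp: path_image_part_circlepath norm_mult subset_iff)
        then show "continuous_on (path_image (part_circlepath 0 \<rho> a c)) f"
          using holf holomorphic_on_imp_continuous_on continuous_on_subset by blast
      qed
      finally have e1: "2 * pi * \<i> * coeff_functional (fps_nth B) h = contour_integral P1 f + contour_integral P2 f" .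
      have holfV: "f holomorphic_on V"
        using holf V0 \<epsilon>(3) by (auto simp: V_def intro: holomorphic_on_subset)
      \<comment> \<open>On the convex set V, which omits 0, the integrand has a primitive. The
        integral over the short arc thus equals the one over the two segments with the same end
        points.\<close>
      obtain H where H: "\<And>z. z \<in> V \<Longrightarrow> (H has_field_derivative f z) (at z within V)"
        using holomorphic_convex_primitive'[OF \<open>convex V\<close> \<open>open V\<close> holfV] by blast
      have "(f has_contour_integral (H (\<rho> * q) - H (\<rho> * p))) P2"
        using contour_integral_primitive[OF H _ P2V] ends by (metis P2_def valid_path_part_circlepath)
      moreover have i1: "(f has_contour_integral (H (\<rho> * m) - H (\<rho> * p))) (linepath (\<rho> * p) (\<rho> * m))"
        using contour_integral_primitive[of V H f "linepath (\<rho> * p) (\<rho> * m)"] H segV by simp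
      moreover have i2: "(f has_contour_integral (H (\<rho> * q) - H (\<rho> * m))) (linepath (\<rho> * m) (\<rho> * q))"
        using contour_integral_primitive[of V H f "linepath (\<rho> * m) (\<rho> * q)"] H segV by simp
      ultimately have e2: "contour_integral P2 f = (H (\<rho> * m) - H (\<rho> * p)) + (H (\<rho> * q) - H (\<rho> * m))"
        by (simp add: contour_integral_unique)
      have M0: "M \<ge> 0"
      proof -
        have "p \<in> \<Gamma>" by (auto simp: \<Gamma>_def A2_def)
        then show ?thesis using M norm_ge_zero order_trans by blast
      qed
      have bd: "norm (f z) \<le> A * M" if "z \<in> S" for z
      proof -
        have "norm (f z) = norm (g z / z) * norm (poly h (1 / z))"
          by (simp add: f_def norm_mult norm_divide)
        also have "\<dots> \<le> A * M"
          using A that M S_scaled[OF that] by (intro mult_mono) auto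
        finally show ?thesis .
      qed
      have AM: "0 \<le> A * M" using A M0 by simp
      have "norm (contour_integral P1 f) \<le> (A * M) * \<rho> * (b - a)"
        unfolding P1_def
      proof (rule has_contour_integral_bound_part_circlepath[OF has_contour_integral_integral AM \<rho>pos less_imp_le[OF abc(1)]])
        show "f contour_integrable_on part_circlepath 0 \<rho> a b"
          by (rule contour_integrable_continuous_part_circlepath)
             (use holf holomorphic_on_imp_continuous_on continuous_on_subset S_sub in \<open>unfold S_def P1_def, blast\<close>)
      qed (use bd in \<open>auto simp: S_def P1_def\<close>)
      moreover have "norm (H (\<rho> * m) - H (\<rho> * p)) \<le> (A * M) * norm (\<rho> * m - \<rho> * p)"
        by (rule has_contour_integral_bound_linepath[OF i1 AM]) (use bd in \<open>auto simp: S_def\<close>)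
      moreover have "norm (H (\<rho> * q) - H (\<rho> * m)) \<le> (A * M) * norm (\<rho> * q - \<rho> * m)"
        by (rule has_contour_integral_bound_linepath[OF i2 AM]) (use bd in \<open>auto simp: S_def\<close>)
      ultimately have "norm (contour_integral P1 f + ((H (\<rho> * m) - H (\<rho> * p)) + (H (\<rho> * q) - H (\<rho> * m)))) \<le> 
         (A * M) * \<rho> * (b - a) + ((A * M) * norm (\<rho> * m - \<rho> * p) + (A * M) * norm (\<rho> * q - \<rho> * m))"
        by (intro norm_triangle_mono)
      also have "\<dots> = A * M * L" by (simp add: L_def algebra_simps)
      finally have "norm (2 * pi * \<i> * coeff_functional (fps_nth B) h) \<le> A * M * L"
        unfolding e1 e2 .
      then show ?thesis by (simp add: norm_mult field_simps)
    qed
    show ?thesis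
      using main A(1) \<open>L \<ge> 0\<close> by (intro exI[of _ "A * L / (2 * pi)"]) auto
  qed
  ultimately show ?thesis by (rule that)
qed

section \<open>A monic polynomial that is small on the contour\<close>

text \<open>Twice the left side plus 1 is exactly (1 - s^2) / |1 - v|^2, and \<eta> bounds the
  denominator from below.\<close>

lemma Re_divide_one_minus_le:
  fixes v :: complex
  assumes "norm v = s" "norm (1 - v) \<ge> \<eta>" "\<eta> > 0" "s \<le> 1"
  shows "Re (v / (1 - v)) \<le> (1 - s\<^sup>2) / (2 * \<eta>\<^sup>2) - 1 / 2"
proof -
  have n: "(norm (1 - v))\<^sup>2 > 0" using assms by auto
  have s: "s\<^sup>2 = (Re v)\<^sup>2 + (Im v)\<^sup>2" using assms(1) cmod_power2[of v] by simp
  have "Re (v / (1 - v)) = (Re v * (1 - Re v) - (Im v)\<^sup>2) / (norm (1 - v))\<^sup>2"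
    by (simp only: Re_divide cmod_power2) (simp add: power2_eq_square)
  also have "Re v * (1 - Re v) - (Im v)\<^sup>2 = ((1 - s\<^sup>2) - (norm (1 - v))\<^sup>2) / 2"
    by (simp add: s cmod_power2) (simp add: power2_eq_square algebra_simps)
  also have "\<dots> / (norm (1 - v))\<^sup>2 = (1 - s\<^sup>2) / (2 * (norm (1 - v))\<^sup>2) - 1 / 2"
    using n by (simp add: field_simps)
  also have "(1 - s\<^sup>2) / (2 * (norm (1 - v))\<^sup>2) \<le> (1 - s\<^sup>2) / (2 * \<eta>\<^sup>2)"
  proof (rule divide_left_mono)
    show "2 * \<eta>\<^sup>2 \<le> 2 * (norm (1 - v))\<^sup>2" using assms by (simp add: power_mono)
    have "s \<ge> 0" using assms(1) by auto
    then show "0 \<le> 1 - s\<^sup>2" using assms(4) by (simp add: power_le_one)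
    show "0 < 2 * (norm (1 - v))\<^sup>2 * (2 * \<eta>\<^sup>2)" using n assms(3) by simp
  qed
  finally show ?thesis by simp
qed

(*
  For s close to 1 the Poisson kernel 1 + 2 Re (v / (1 - v)), v = s z / w, is close to 0 off a
  neighbourhood of w, so Re (v / (1 - v)) is close to -1/2 there.
*)
lemma Re_geometric_neg:
  fixes A :: "complex set" and w :: complex
  assumes A: "closed A" "A \<subseteq> sphere 0 1" "norm w = 1" "w \<notin> A"
  obtains s :: real and n :: nat where "n \<ge> 1"
    "\<And>z. z \<in> A \<Longrightarrow> Re (\<Sum>k=1..n. (s / w * z) ^ k) < 0"
proof -
  obtain \<delta> where \<delta>: "\<delta> > 0" "\<And>z. z \<in> A \<Longrightarrow> \<delta> \<le> dist w z"
    using separate_point_closed[OF A(1,4)] by blast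
  \<comment> \<open>The three bounds on t keep s positive, keep |1 - v| at least \<delta>/2, and
    make the kernel term at most 1/4. With the tail below 1/4 by the choice of n, the total is less
    than -1/2 + 1/4 + 1/4 = 0.\<close>
  define t where "t = min (1/2) (min (\<delta>/2) (\<delta>\<^sup>2/16))"
  have t: "0 < t" "t \<le> 1/2" "t \<le> \<delta>/2" "t \<le> \<delta>\<^sup>2/16" using \<delta>(1) by (auto simp: t_def)
  define s where "s = 1 - t"
  have s: "0 < s" "s < 1" using t by (auto simp: s_def)
  obtain n where n: "s ^ n < \<delta> / 8"
    using real_arch_pow_inv[of "\<delta> / 8" s] \<delta> s by auto
  show ?thesis
  proof (rule that[of "Suc n" s])
    fix z assume z: "z \<in> A"
    define v where "v = s / w * z"
    have "w \<noteq> 0" using A(3) by auto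
    have nz: "norm z = 1" using z A(2) by auto
    have nv: "norm v = s" using s A(3) nz by (simp add: v_def norm_mult norm_divide)
    have "norm (1 - v) = norm (w * (1 - v))" by (simp add: norm_mult A(3))
    also have "w * (1 - v) = (w - z) + of_real t * z"
      using \<open>w \<noteq> 0\<close> by (simp add: v_def s_def field_simps)
    also have "norm \<dots> \<ge> norm (w - z) - norm (of_real t * z)"
      by norm
    also have "norm (w - z) - norm (of_real t * z) \<ge> \<delta> / 2"
      using \<delta>(2)[OF z] t nz by (simp add: norm_mult dist_norm)
    finally have nv1: "norm (1 - v) \<ge> \<delta> / 2" .
    then have "v \<noteq> 1" using \<delta>(1) by auto
    have "(1 - v) * (\<Sum>k=1..Suc n. v ^ k) = v - v ^ (Suc (Suc n))"
      using sum_gp_multiplied[of 1 "Suc n" v] by simp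
    then have "(\<Sum>k=1..Suc n. v ^ k) = (v - v ^ (Suc (Suc n))) / (1 - v)"
      using \<open>v \<noteq> 1\<close> nonzero_mult_div_cancel_left[of "1 - v" "\<Sum>k=1..Suc n. v ^ k"] by auto
    then have e1: "Re (\<Sum>k=1..Suc n. v ^ k) = Re (v / (1 - v)) - Re (v ^ (Suc (Suc n)) / (1 - v))"
      by (simp add: diff_divide_distrib del: power_Suc)
    have e2: "Re (v / (1 - v)) \<le> (1 - s\<^sup>2) / (2 * (\<delta> / 2)\<^sup>2) - 1 / 2"
      by (rule Re_divide_one_minus_le) (use nv nv1 \<delta> s in auto)
    have e3: "(1 - s\<^sup>2) / (2 * (\<delta> / 2)\<^sup>2) \<le> 1 / 4"
    proof -
      have "1 - s\<^sup>2 \<le> 2 * t" by (simp add: s_def power2_eq_square algebra_simps)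
      also have "\<dots> \<le> \<delta>\<^sup>2 / 8" using t by simp
      finally show ?thesis using \<delta>(1) by (simp add: field_simps power2_eq_square)
    qed
    have e4: "- Re (v ^ (Suc (Suc n)) / (1 - v)) < 1 / 4"
    proof -
      have "- Re (v ^ (Suc (Suc n)) / (1 - v)) \<le> norm (v ^ (Suc (Suc n)) / (1 - v))"
        using abs_Re_le_cmod abs_le_D2 by blast
      also have "\<dots> = s ^ Suc (Suc n) / norm (1 - v)" by (simp add: norm_divide norm_power nv norm_mult)
      also have "\<dots> \<le> s ^ n / (\<delta> / 2)"
        using s nv1 \<delta>(1) by (intro frac_le power_decreasing) auto
      also have "\<dots> < 1 / 4" using n \<delta>(1) by (simp add: field_simps)
      finally show ?thesis .
    qed
    show "Re (\<Sum>k=1..Suc n. (s / w * z) ^ k) < 0"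
      using e1 e2 e3 e4 unfolding v_def[symmetric] by linarith
  qed simp
qed

text \<open>A small positive \<kappa> works at each point: where |z| > 1 the right side already
  exceeds 1, and where |z| = 1 the square of the left side has derivative 2 Re u < 0 at \<kappa> =
  0. Compactness makes \<kappa> uniform: counterexamples for \<kappa> = 1/(j+1) would accumulate at
  a point that contradicts one of the two cases.\<close>

lemma perturbation_small:
  fixes u :: "complex \<Rightarrow> complex"
  assumes "compact \<Gamma>" "\<And>z. z \<in> \<Gamma> \<Longrightarrow> norm z \<ge> 1" "continuous_on UNIV u"
    "\<And>z. z \<in> \<Gamma> \<Longrightarrow> norm z = 1 \<Longrightarrow> Re (u z) < 0" "n \<ge> 1"
  obtains \<kappa> :: real where "\<And>z. z \<in> \<Gamma> \<Longrightarrow> norm (1 + \<kappa> * u z) < norm z ^ n"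
proof (rule ccontr)
  assume "\<not> thesis"
  then have "\<forall>j. \<exists>z\<in>\<Gamma>. norm (1 + (1 / real (Suc j)) * u z) \<ge> norm z ^ n"
    using that by (meson not_less)
  then obtain x where x: "\<And>j. x j \<in> \<Gamma>" "\<And>j. norm (1 + (1 / real (Suc j)) * u (x j)) \<ge> norm (x j) ^ n"
    by metis
  then obtain l r where lr: "l \<in> \<Gamma>" "strict_mono r" "(x \<circ> r) \<longlonglongrightarrow> l"
    using assms(1) unfolding compact_def by metis
  have \<kappa>: "(\<lambda>j. 1 / real (Suc (r j))) \<longlonglongrightarrow> 0"
    using LIMSEQ_subseq_LIMSEQ[OF LIMSEQ_inverse_real_of_nat lr(2)] by (simp add: o_def inverse_eq_divide)
  have xl: "(\<lambda>j. x (r j)) \<longlonglongrightarrow> l" using lr(3) by (simp add: o_def)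
  have ul: "(\<lambda>j. u (x (r j))) \<longlonglongrightarrow> u l"
    using assms(3) xl by (auto simp: continuous_on_eq_continuous_at intro: isCont_tendsto_compose)
  show False
  proof (cases "norm l = 1")
    case False
    then have "norm l > 1" using assms(2)[OF lr(1)] by simp
    then have "norm l ^ n > 1" using assms(5) by (simp add: one_less_power)
    moreover have "(\<lambda>j. norm (1 + complex_of_real (1 / real (Suc (r j))) * u (x (r j)))) \<longlonglongrightarrow> norm (1 + complex_of_real 0 * u l)"
      by (intro tendsto_intros \<kappa> ul)
    moreover have "(\<lambda>j. norm (x (r j)) ^ n) \<longlonglongrightarrow> norm l ^ n"
      by (intro tendsto_intros xl)
    ultimately have "norm l ^ n \<le> norm (1 + complex_of_real 0 * u l)"
      using x(2) by (intro LIMSEQ_le) auto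
    then show False using \<open>norm l ^ n > 1\<close> by simp
  next
    case True
    have ineq: "0 \<le> 2 * Re (u (x (r j))) + (1 / real (Suc (r j))) * (norm (u (x (r j))))\<^sup>2" for j
    proof -
      define k where "k = 1 / real (Suc (r j))"
      define y where "y = u (x (r j))"
      have "k > 0" by (simp add: k_def)
      have "1 \<le> norm (x (r j)) ^ n" using assms(2) x(1) by simp
      also have "\<dots> \<le> norm (1 + k * y)" using x(2) by (simp add: k_def y_def)
      finally have "1 \<le> (norm (1 + k * y))\<^sup>2" by (simp add: power2_eq_square mult_ge1_I)
      also have "\<dots> = 1 + k * (2 * Re y + k * (norm y)\<^sup>2)"
        by (simp add: cmod_power2) (simp add: power2_eq_square algebra_simps)
      finally have "0 \<le> k * (2 * Re y + k * (norm y)\<^sup>2)" by simp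
      then have "0 \<le> 2 * Re y + k * (norm y)\<^sup>2" using \<open>k > 0\<close> by (simp add: zero_le_mult_iff)
      then show ?thesis unfolding k_def y_def .
    qed
    have "(\<lambda>j. 2 * Re (u (x (r j))) + (1 / real (Suc (r j))) * (norm (u (x (r j))))\<^sup>2) \<longlonglongrightarrow> 2 * Re (u l) + 0 * (norm (u l))\<^sup>2"
      by (intro tendsto_intros \<kappa> ul)
    then have "0 \<le> 2 * Re (u l) + 0 * (norm (u l))\<^sup>2"
      using ineq by (intro LIMSEQ_le_const) auto
    then show False using assms(4)[OF lr(1) True] by simp
  qed
qed

(* T (1/z) = z^(-d) (1 + \<kappa> u z), where u is the geometric sum of the previous lemmas and d = n m. *)
lemma polynomial_small_on_compact:
  assumes "compact \<Gamma>" "\<And>z. z \<in> \<Gamma> \<Longrightarrow> norm z \<ge> 1" "norm w = 1" "w \<notin> \<Gamma>" "m \<ge> 1"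
  obtains T :: "complex poly" and d :: nat where "d > 0" "degree T = d" "coeff T d = 1"
    "\<And>i. coeff T i \<noteq> 0 \<Longrightarrow> d * (m - 1) \<le> i * m"
    "\<And>z. z \<in> \<Gamma> \<Longrightarrow> norm (poly T (1 / z)) < 1"
proof -
  have "closed (\<Gamma> \<inter> sphere 0 1)" using assms(1) by (auto intro: compact_imp_closed)
  then obtain s :: real and n where n: "n \<ge> 1"
      and re: "\<And>z. z \<in> \<Gamma> \<inter> sphere 0 1 \<Longrightarrow> Re (\<Sum>k=1..n. (s / w * z) ^ k) < 0"
    using Re_geometric_neg[of "\<Gamma> \<inter> sphere 0 1" w] assms by (metis IntD1 inf_le2)
  define u where "u z = (\<Sum>k=1..n. (s / w * z) ^ k)" for z
  obtain \<kappa> :: real where \<kappa>: "\<And>z. z \<in> \<Gamma> \<Longrightarrow> norm (1 + \<kappa> * u z) < norm z ^ n"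
  proof (rule perturbation_small[of \<Gamma> u n])
    show "continuous_on UNIV u" unfolding u_def by (intro continuous_intros)
  qed (use assms n re in \<open>auto simp: u_def\<close>)
  \<comment> \<open>The exponents of T lie between d - n and d, and this d gives (d - n) m = d (m -
    1), so they are at least (1 - 1/m) d.\<close>
  define d where "d = n * m"
  have d: "d \<ge> n" "d \<ge> 1" using n assms(5) by (auto simp: d_def)
  define T where "T = monom 1 d + (\<Sum>k=1..n. monom (\<kappa> * (s / w) ^ k) (d - k))"
  have coeffT: "coeff T i = (if i = d then 1 else 0) + (\<Sum>k=1..n. if d - k = i then \<kappa> * (s / w) ^ k else 0)" for i
    by (simp add: T_def coeff_sum)
  have big: "(\<Sum>k=1..n. if d - k = i then \<kappa> * (s / w) ^ k else 0) = 0" if "i \<ge> d" for i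
    by (rule sum.neutral) (use that d n in auto)
  have c1: "coeff T d = 1" using big[of d] by (simp add: coeffT)
  have deg: "degree T = d"
    using c1 big by (intro antisym degree_le le_degree) (auto simp: coeffT)
  show ?thesis
  proof (rule that[of d T, OF _ deg c1])
    show "d > 0" using d by simp
    fix i assume "coeff T i \<noteq> 0"
    then have "i \<ge> d - n"
      by (rule contrapos_np) (use d n in \<open>auto simp: coeffT intro!: sum.neutral\<close>)
    then have "(d - n) * m \<le> i * m" by simp
    moreover have "(d - n) * m = d * (m - 1)" by (simp add: d_def algebra_simps)
    ultimately show "d * (m - 1) \<le> i * m" by simp
  next
    fix z assume z: "z \<in> \<Gamma>"
    have "norm z \<ge> 1" using assms(2) z by auto
    then have "z \<noteq> 0" by auto
    have "poly T (1 / z) = (1 / z) ^ d + (\<Sum>k=1..n. \<kappa> * (s / w) ^ k * (1 / z) ^ (d - k))"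
      by (simp add: T_def poly_sum poly_monom)
    also have "(\<Sum>k=1..n. \<kappa> * (s / w) ^ k * (1 / z) ^ (d - k)) = (\<Sum>k=1..n. (1 / z) ^ d * (\<kappa> * (s / w * z) ^ k))"
      using \<open>z \<noteq> 0\<close> d by (intro sum.cong) (auto simp: power_diff power_mult_distrib field_simps)
    also have "(1 / z) ^ d + \<dots> = (1 / z) ^ d * (1 + \<kappa> * u z)"
      by (simp add: u_def sum_distrib_left distrib_left)
    finally have "norm (poly T (1 / z)) = norm (1 + \<kappa> * u z) / norm z ^ d"
      by (simp add: norm_mult norm_power norm_divide power_divide)
    also have "\<dots> < norm z ^ n / norm z ^ d"
      using \<kappa>[OF z] \<open>z \<noteq> 0\<close> by (intro divide_strict_right_mono) auto
    also have "\<dots> \<le> 1"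
      using \<open>norm z \<ge> 1\<close> \<open>z \<noteq> 0\<close> d by (simp add: divide_le_eq_1 power_increasing)
    finally show "norm (poly T (1 / z)) < 1" .
  qed
qed

text \<open>The strict inequality |T(1/z)| < 1 on the compact contour leaves a margin that uniform
  continuity of T spends on passing from 1/z to 1/(\<rho> z). C may depend on \<rho>, which is
  harmless because \<rho> is fixed before k varies. The range l < 2 d admits products of two basis
  elements z^l T^k with l < d.\<close>

lemma coeff_functional_geometric_decay:
  fixes B :: "complex fps"
  assumes U: "open U" "w \<in> U" "norm w = 1" "ball 0 1 \<subseteq> U" "g holomorphic_on U"
    and B: "fps_conv_radius B \<ge> 1" "\<And>z. z \<in> ball 0 1 \<Longrightarrow> g z = eval_fps B z" and m: "m \<ge> 1"
  obtains T :: "complex poly" and d :: nat and \<theta> C :: real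
  where "d > 0" "degree T = d" "coeff T d = 1" "\<And>i. coeff T i \<noteq> 0 \<Longrightarrow> d * (m - 1) \<le> i * m"
    "0 < \<theta>" "\<theta> < 1" "0 \<le> C"
    "\<And>k l. l < 2 * d \<Longrightarrow> norm (coeff_functional (fps_nth B) (monom 1 l * T ^ k)) \<le> C * \<theta> ^ k"
proof -
  obtain \<alpha> where \<alpha>: "w = cis \<alpha>" using U(3) by (metis complex_norm_eq_1_exp cis_conv_exp)
  obtain \<Gamma> \<rho>0 where \<Gamma>: "compact \<Gamma>" "\<And>z. z \<in> \<Gamma> \<Longrightarrow> norm z \<ge> 1" "w \<notin> \<Gamma>" "\<rho>0 < 1"
    "\<And>\<rho>. \<rho>0 < \<rho> \<Longrightarrow> \<rho> < 1 \<Longrightarrow> \<exists>C\<ge>0. \<forall>h M. (\<forall>z\<in>\<Gamma>. norm (poly h (1 / (of_real \<rho> * z))) \<le> M) \<longrightarrow>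
       norm (coeff_functional (fps_nth B) h) \<le> C * M"
    using coeff_functional_contour_bound[of U \<alpha> g B] U B \<alpha> by metis
  obtain T d where T: "d > 0" "degree T = d" "coeff T d = 1"
    "\<And>i. coeff T i \<noteq> 0 \<Longrightarrow> d * (m - 1) \<le> i * m"
    "\<And>z. z \<in> \<Gamma> \<Longrightarrow> norm (poly T (1 / z)) < 1"
    by (rule polynomial_small_on_compact[OF \<Gamma>(1,2) U(3) \<Gamma>(3) m]) (assumption, rule that)
  obtain \<theta>0 where \<theta>0: "0 \<le> \<theta>0" "\<theta>0 < 1" "\<And>z. z \<in> \<Gamma> \<Longrightarrow> norm (poly T (1 / z)) \<le> \<theta>0"
  proof (cases "\<Gamma> = {}")
    case False
    have "continuous_on \<Gamma> (\<lambda>z. norm (poly T (1 / z)))"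
      using \<Gamma>(2) by (intro continuous_intros) fastforce
    then obtain y where "y \<in> \<Gamma>" "\<And>z. z \<in> \<Gamma> \<Longrightarrow> norm (poly T (1 / z)) \<le> norm (poly T (1 / y))"
      using continuous_attains_sup[OF \<Gamma>(1) False] by metis
    then show ?thesis using T(5) that[of "norm (poly T (1 / y))"] by auto
  qed (use that[of 0] in auto)
  define \<theta> where "\<theta> = (1 + \<theta>0) / 2"
  have \<theta>: "0 < \<theta>" "\<theta> < 1" "\<theta>0 < \<theta>" using \<theta>0 by (auto simp: \<theta>_def)
  have "uniformly_continuous_on (cball 0 2) (poly T)"
    by (intro compact_uniformly_continuous continuous_intros) auto
  then obtain \<delta> where \<delta>: "\<delta> > 0" "\<And>x y. x \<in> cball 0 2 \<Longrightarrow> y \<in> cball 0 2 \<Longrightarrow> dist x y < \<delta> \<Longrightarrow>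
      dist (poly T x) (poly T y) < \<theta> - \<theta>0"
    unfolding uniformly_continuous_on_def using \<theta>(3) by (metis diff_gt_0_iff_gt)
  \<comment> \<open>The bound 1/2 keeps 1/(\<rho> z) in the disc of radius 2, and 1/(1 + \<delta>)
    makes 1/\<rho> - 1 smaller than \<delta>.\<close>
  obtain \<rho> where \<rho>: "max \<rho>0 (max (1/2) (1 / (1 + \<delta>))) < \<rho>" "\<rho> < 1"
    using dense[of "max \<rho>0 (max (1/2) (1 / (1 + \<delta>)))" 1] \<Gamma>(4) \<delta>(1) by auto
  have \<rho>1: "1 / \<rho> \<le> 2" using \<rho> by (simp add: field_simps)
  have \<rho>2: "1 / \<rho> - 1 < \<delta>"
    using \<rho> \<delta>(1) by (simp add: field_simps)
  obtain C where C: "C \<ge> 0" "\<And>h M. (\<And>z. z \<in> \<Gamma> \<Longrightarrow> norm (poly h (1 / (of_real \<rho> * z))) \<le> M) \<Longrightarrow>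
       norm (coeff_functional (fps_nth B) h) \<le> C * M"
    using \<Gamma>(5)[of \<rho>] \<rho> by auto
  have small: "norm (poly T (1 / (of_real \<rho> * z))) \<le> \<theta>" "norm (1 / (of_real \<rho> * z)) \<le> 2" if "z \<in> \<Gamma>" for z
  proof -
    have z: "norm z \<ge> 1" "z \<noteq> 0" using \<Gamma>(2) that by fastforce+
    then have z1: "norm (1 / z) \<le> 1" by (simp add: norm_divide field_simps)
    have "norm (1 / (of_real \<rho> * z)) = 1 / \<rho> * norm (1 / z)"
      using \<rho> by (simp add: norm_divide norm_mult)
    also have "\<dots> \<le> 2 * 1" using \<rho>1 z1 \<rho> by (intro mult_mono) auto
    finally show n2: "norm (1 / (of_real \<rho> * z)) \<le> 2" by simp
    have "1 / (of_real \<rho> * z) - 1 / z = of_real (1 / \<rho> - 1) * (1 / z)"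
      using \<rho> z by (simp add: field_simps)
    then have "norm (1 / (of_real \<rho> * z) - 1 / z) = (1 / \<rho> - 1) * norm (1 / z)"
      using \<rho> by (simp only: norm_mult norm_of_real) simp
    also have "\<dots> \<le> (1 / \<rho> - 1) * 1" using z1 \<rho> by (intro mult_left_mono) auto
    finally have "dist (1 / (of_real \<rho> * z)) (1 / z) < \<delta>" using \<rho>2 by (simp add: dist_norm)
    then have "dist (poly T (1 / (of_real \<rho> * z))) (poly T (1 / z)) < \<theta> - \<theta>0"
      using n2 z1 by (intro \<delta>(2)) auto
    then show "norm (poly T (1 / (of_real \<rho> * z))) \<le> \<theta>"
      using \<theta>0(3)[OF that] by norm
  qed
  show ?thesis
  proof (rule that[OF T(1-4) \<theta>(1,2), of "C * 2 ^ (2 * d)"])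
    fix k l :: nat assume l: "l < 2 * d"
    have "norm (coeff_functional (fps_nth B) (monom 1 l * T ^ k)) \<le> C * (2 ^ (2 * d) * \<theta> ^ k)"
    proof (rule C(2))
      fix z assume z: "z \<in> \<Gamma>"
      have "norm (poly (monom 1 l * T ^ k) (1 / (of_real \<rho> * z))) =
          norm (1 / (of_real \<rho> * z)) ^ l * norm (poly T (1 / (of_real \<rho> * z))) ^ k"
        by (simp add: poly_monom norm_mult norm_power)
      also have "\<dots> \<le> 2 ^ l * \<theta> ^ k"
        using small[OF z] by (intro mult_mono power_mono) auto
      also have "\<dots> \<le> 2 ^ (2 * d) * \<theta> ^ k"
        using l \<theta> by (intro mult_right_mono power_increasing) auto
      finally show "norm (poly (monom 1 l * T ^ k) (1 / (of_real \<rho> * z))) \<le> 2 ^ (2 * d) * \<theta> ^ k" .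
    qed
    then show "norm (coeff_functional (fps_nth B) (monom 1 l * T ^ k)) \<le> C * 2 ^ (2 * d) * \<theta> ^ k"
      by (simp add: mult.assoc)
  qed (use C in auto)
qed

section \<open>Integer coefficients\<close>


lemma coeff_functional_eq:
  assumes "degree h \<le> N"
  shows "coeff_functional b h = (\<Sum>i\<le>N. coeff h i * b i)"
  unfolding coeff_functional_def using assms
  by (intro sum.mono_neutral_left) (auto simp: coeff_eq_0)

lemma coeff_functional_add: "coeff_functional b (p + q) = coeff_functional b p + coeff_functional b q"
proof -
  define N where "N = max (degree p) (degree q)"
  have "degree p \<le> N" "degree q \<le> N" "degree (p + q) \<le> N"
    by (auto simp: N_def intro: degree_add_le)
  then show ?thesis
    by (simp add: coeff_functional_eq[of _ N] distrib_right sum.distrib)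
qed

lemma coeff_functional_0 [simp]: "coeff_functional b 0 = 0"
  by (simp add: coeff_functional_def)

lemma coeff_functional_sum: "coeff_functional b (\<Sum>x\<in>A. f x) = (\<Sum>x\<in>A. coeff_functional b (f x))"
  by (induction A rule: infinite_finite_induct) (auto simp: coeff_functional_add)

lemma coeff_functional_smult: "coeff_functional b (Polynomial.smult c p) = c * coeff_functional b p"
  using coeff_functional_eq[OF degree_smult_le[of c p], of b]
  by (simp add: coeff_functional_def sum_distrib_left mult.assoc)

lemma coeff_functional_monom: "coeff_functional b (Polynomial.monom c n) = c * b n"
  using coeff_functional_eq[OF degree_monom_le[of c n], of b]
  by (simp add: if_distrib[of "\<lambda>x. x * _"] sum.delta cong: if_cong)

lemma coeff_functional_mult:
  assumes "degree q \<le> N"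
  shows "coeff_functional b (p * q) = (\<Sum>k\<le>N. coeff q k * coeff_functional b (Polynomial.monom 1 k * p))"
proof -
  have "q = (\<Sum>k\<le>N. Polynomial.smult (coeff q k) (Polynomial.monom 1 k))"
    using poly_as_sum_of_monoms'[OF assms] by (simp add: smult_monom)
  then have "p * q = p * (\<Sum>k\<le>N. Polynomial.smult (coeff q k) (Polynomial.monom 1 k))"
    by (rule arg_cong)
  also have "\<dots> = (\<Sum>k\<le>N. Polynomial.smult (coeff q k) (Polynomial.monom 1 k * p))"
    by (simp add: sum_distrib_left mult.commute)
  finally have "p * q = (\<Sum>k\<le>N. Polynomial.smult (coeff q k) (Polynomial.monom 1 k * p))" .
  then show ?thesis by (simp add: coeff_functional_sum coeff_functional_smult)
qed

lemma coeff_functional_shift: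
  assumes "degree p \<le> N"
  shows "coeff_functional b (Polynomial.monom 1 j * p) = (\<Sum>i\<le>N. coeff p i * b (i + j))"
  by (subst coeff_functional_mult[OF assms]) (simp add: mult_monom coeff_functional_monom add.commute)

(*
  A kernel polynomial P of least degree works for all j. If P annihilates the shifts j < m and Q
  the shifts j \<le> m, with degree P \<le> degree Q = e \<le> m, then expanding the functional at
  z^(m - e) P Q along Q leaves only the top coefficient of Q times the value at z^m P, while
  expanding it along P gives 0.
*)
lemma kernel_polynomial_of_finite_kernels:
  assumes "\<And>n. n \<ge> N0 \<Longrightarrow> \<exists>P. P \<noteq> 0 \<and> degree P < n \<and> (\<forall>j<n. coeff_functional b (Polynomial.monom 1 j * P) = 0)"
  obtains P where "P \<noteq> 0" "\<And>j. coeff_functional b (Polynomial.monom 1 j * P) = 0"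
proof -
  define K where "K n P \<longleftrightarrow> P \<noteq> 0 \<and> degree P < n \<and> (\<forall>j<n. coeff_functional b (Polynomial.monom 1 j * P) = 0)" for n P
  have ex: "\<exists>P. K n P" if "n \<ge> N0" for n
    using assms[OF that] by (auto simp: K_def)
  \<comment> \<open>The minimum is taken over all sizes n at once, so it also bounds the degrees of
    the kernel polynomials of every larger size.\<close>
  define p where "p = (LEAST p. \<exists>n\<ge>N0. \<exists>P. K n P \<and> degree P = p)"
  have "\<exists>p. \<exists>n\<ge>N0. \<exists>P. K n P \<and> degree P = p" using ex by blast
  then have "\<exists>n\<ge>N0. \<exists>P. K n P \<and> degree P = p"
    unfolding p_def by (rule LeastI_ex)
  then obtain n P where n: "n \<ge> N0" and P: "K n P" "degree P = p" by blast
  have min: "p \<le> degree Q" if "K m Q" "m \<ge> N0" for m Q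
    unfolding p_def by (rule Least_le) (use that in blast)
  have Km: "K m P" if "m \<ge> n" for m
    using that
  proof (induction m rule: dec_induct)
    case base
    show ?case by (rule P)
  next
    case (step m)
    obtain Q where Q: "K (Suc m) Q" using ex[of "Suc m"] step.hyps n by auto
    define e where "e = degree Q"
    have e: "p \<le> e" "e \<le> m" using min[OF Q] Q step.hyps n by (auto simp: e_def K_def)
    have "coeff_functional b ((Polynomial.monom 1 (m - e) * P) * Q) =
        (\<Sum>k\<le>e. coeff Q k * coeff_functional b (Polynomial.monom 1 (k + (m - e)) * P))"
      by (subst coeff_functional_mult[of Q e]) (simp_all add: e_def mult_monom flip: mult.assoc)
    also have "\<dots> = (\<Sum>k\<le>e. if k = e then coeff Q e * coeff_functional b (Polynomial.monom 1 m * P) else 0)"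
      using e step.IH by (intro sum.cong) (auto simp: K_def)
    also have "\<dots> = coeff Q e * coeff_functional b (Polynomial.monom 1 m * P)" by simp
    finally have 1: "coeff_functional b ((Polynomial.monom 1 (m - e) * P) * Q) =
      coeff Q e * coeff_functional b (Polynomial.monom 1 m * P)" .
    have "coeff_functional b ((Polynomial.monom 1 (m - e) * Q) * P) =
        (\<Sum>k\<le>p. coeff P k * coeff_functional b (Polynomial.monom 1 (k + (m - e)) * Q))"
      by (subst coeff_functional_mult[of P p]) (simp_all add: P mult_monom flip: mult.assoc)
    also have "\<dots> = 0"
      using Q e by (intro sum.neutral) (auto simp: K_def)
    finally have "coeff Q e * coeff_functional b (Polynomial.monom 1 m * P) = 0"
      using 1 by (simp add: mult_ac)
    moreover have "coeff Q e \<noteq> 0" using Q by (simp add: K_def e_def)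
    ultimately show ?case using step.IH by (auto simp: K_def less_Suc_eq)
  qed
  show ?thesis
  proof (rule that[of P])
    show "P \<noteq> 0" using P by (simp add: K_def)
    show "coeff_functional b (Polynomial.monom 1 j * P) = 0" for j
      using Km[of "max n (Suc j)"] by (auto simp: K_def)
  qed
qed

section \<open>Hankel determinants\<close>

text \<open>Every term of the Leibniz expansion has the same total exponent, because the sum of i +
  p i over i is n (n - 1) for every permutation p. The n! terms cost at most n^n, which is one
  factor n per row and loses against t^(n-1).\<close>

lemma det_norm_bound:
  fixes E :: "complex mat"
  assumes "E \<in> carrier_mat n n" "\<And>i j. i < n \<Longrightarrow> j < n \<Longrightarrow> norm (E $$ (i, j)) \<le> K * t ^ (i + j)" "0 \<le> K" "0 \<le> t"
  shows "norm (Determinant.det E) \<le> (n * K * t ^ (n - 1)) ^ n"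
proof -
  have "Determinant.det E = (\<Sum>p | p permutes {0..<n}. of_int (sign p) * (\<Prod>i = 0..<n. E $$ (i, p i)))"
    using assms(1) by (simp add: Determinant.det_def)
  also have "norm \<dots> \<le> (\<Sum>p | p permutes {0..<n}. norm (of_int (sign p) * (\<Prod>i = 0..<n. E $$ (i, p i))))"
    by (rule norm_sum)
  also have "\<dots> \<le> (\<Sum>p | p permutes {0..<n}. (K * t ^ (n - 1)) ^ n)"
  proof (rule sum_mono)
    fix p assume "p \<in> {p. p permutes {0..<n}}"
    then have p: "p permutes {0..<n}" by simp
    have "norm (of_int (sign p) * (\<Prod>i = 0..<n. E $$ (i, p i))) = (\<Prod>i = 0..<n. norm (E $$ (i, p i)))"
      by (simp add: norm_mult prod_norm sign_def)
    also have "\<dots> \<le> (\<Prod>i = 0..<n. K * t ^ (i + p i))"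
      using assms(2) permutes_in_image[OF p] by (intro prod_mono) auto
    also have "\<dots> = K ^ n * t ^ (\<Sum>i = 0..<n. i + p i)"
      by (simp add: prod.distrib power_sum)
    also have "(\<Sum>i = 0..<n. i + p i) = n * (n - 1)"
    proof -
      have "(\<Sum>i = 0..<n. p i) = (\<Sum>i = 0..<n. i)"
        using sum.permute[OF p, of "\<lambda>i. i"] by (simp add: o_def)
      then have "(\<Sum>i = 0..<n. i + p i) = 2 * (\<Sum>i = 0..<n. i)"
        by (simp add: sum.distrib)
      also have "\<dots> = n * (n - 1)"
      proof -
        have "even (n * (n - 1))" by (cases n) auto
        then show ?thesis by (simp add: Sum_Ico_nat)
      qed
      finally show ?thesis .
    qed
    also have "K ^ n * t ^ (n * (n - 1)) = (K * t ^ (n - 1)) ^ n"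
      by (simp add: power_mult_distrib power_mult[symmetric] mult.commute)
    finally show "norm (of_int (sign p) * (\<Prod>i = 0..<n. E $$ (i, p i))) \<le> (K * t ^ (n - 1)) ^ n" .
  qed
  also have "\<dots> = fact n * (K * t ^ (n - 1)) ^ n"
    by (simp add: card_permutations[of "{0..<n}" n])
  also have "\<dots> \<le> n ^ n * (K * t ^ (n - 1)) ^ n"
  proof (rule mult_right_mono)
    show "(fact n :: real) \<le> n ^ n" using fact_le_power[of n, where ?'a = real] by simp
  qed (use assms(3,4) in auto)
  finally show ?thesis by (simp add: power_mult_distrib mult.assoc)
qed

text \<open>Both are Gram matrices of the bilinear form sending (p, q) to the functional at p q, in
  the bases z^i and e i. The transition matrix is triangular with unit diagonal.\<close>

lemma det_hankel_change_basis:
  fixes e :: "nat \<Rightarrow> complex poly"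
  assumes "\<And>i. degree (e i) = i" "\<And>i. coeff (e i) i = 1"
  shows "Determinant.det (Matrix.mat n n (\<lambda>(i, j). b (i + j))) =
         Determinant.det (Matrix.mat n n (\<lambda>(i, j). coeff_functional b (e i * e j)))"
proof (cases "n = 0")
  case False
  define A where "A = Matrix.mat n n (\<lambda>(i, j). b (i + j))"
  define L where "L = Matrix.mat n n (\<lambda>(i, j). coeff (e i) j)"
  have car: "A \<in> carrier_mat n n" "L \<in> carrier_mat n n" by (auto simp: A_def L_def)
  have "Determinant.det L = prod_list (diag_mat L)"
    by (rule det_lower_triangular[OF _ car(2)]) (auto simp: L_def coeff_eq_0 assms)
  also have "\<dots> = 1"
    by (simp add: prod_list_diag_prod L_def assms)
  finally have detL: "Determinant.det L = 1" .
  have "Matrix.mat n n (\<lambda>(i, j). coeff_functional b (e i * e j)) = L * A * Matrix.transpose_mat L"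
  proof (rule eq_matI)
    fix i j assume "i < dim_row (L * A * Matrix.transpose_mat L)" "j < dim_col (L * A * Matrix.transpose_mat L)"
    then have ij: "i < n" "j < n" by (auto simp: L_def)
    have "coeff_functional b (e i * e j) = (\<Sum>l<n. coeff (e j) l * (\<Sum>k<n. coeff (e i) k * b (k + l)))"
      using ij assms(1) False
      by (subst coeff_functional_mult[of _ "n - 1"], simp)
         (subst coeff_functional_shift[of _ "n - 1"], auto simp flip: lessThan_Suc_atMost)
    also have "\<dots> = (L * A * Matrix.transpose_mat L) $$ (i, j)"
      using ij by (simp add: L_def A_def scalar_prod_def atLeast0LessThan mult.commute)
    finally show "Matrix.mat n n (\<lambda>(i, j). coeff_functional b (e i * e j)) $$ (i, j) =
      (L * A * Matrix.transpose_mat L) $$ (i, j)" using ij by simp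
  qed (auto simp: L_def)
  then have "Determinant.det (Matrix.mat n n (\<lambda>(i, j). coeff_functional b (e i * e j))) =
      Determinant.det L * Determinant.det A * Determinant.det (Matrix.transpose_mat L)"
    using car by (metis Determinant.det_mult mult_carrier_mat transpose_carrier_mat)
  then show ?thesis using car by (simp add: detL Determinant.det_transpose A_def)
qed simp

text \<open>Rounding i / d down costs at most one factor \<theta>.\<close>

lemma power_div_le_root_power:
  fixes \<theta> :: real
  assumes "0 < d" "0 < \<theta>" "\<theta> < 1"
  shows "\<theta> ^ (i div d) \<le> root d \<theta> ^ i / \<theta>"
proof -
  have "\<theta> ^ (i div d) * \<theta> = root d \<theta> ^ (d * (i div d) + d)"
    using assms by (simp add: power_add power_mult)
  also have "\<dots> \<le> root d \<theta> ^ i"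
  proof (rule power_decreasing)
    have "i = d * (i div d) + i mod d" by simp
    also have "\<dots> \<le> d * (i div d) + d" using assms by (intro add_left_mono) (simp add: less_imp_le)
    finally show "i \<le> d * (i div d) + d" .
  qed (use assms in auto)
  finally show ?thesis using assms by (simp add: field_simps)
qed

lemma integer_hankel_det_vanishes:
  fixes b :: "nat \<Rightarrow> complex" and T :: "complex poly"
  assumes T: "d > 0" "degree T = d" "coeff T d = 1" and \<theta>: "0 < \<theta>" "\<theta> < 1" "0 \<le> C"
    and bound: "\<And>k l. l < 2 * d \<Longrightarrow> norm (coeff_functional b (Polynomial.monom 1 l * T ^ k)) \<le> C * \<theta> ^ k"
    and int: "\<And>i. b i \<in> \<int>"
  obtains N0 where "\<And>n. n \<ge> N0 \<Longrightarrow> Determinant.det (Matrix.mat n n (\<lambda>(i, j). b (i + j))) = 0"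
proof -
  \<comment> \<open>One monic polynomial in each degree i. A product of two of them is again z^l T^k
    with l < 2 d, so the decay estimate applies to it.\<close>
  define e where "e i = Polynomial.monom 1 (i mod d) * T ^ (i div d)" for i
  have "T \<noteq> 0" using T by auto
  have "lead_coeff (T ^ k) = 1" for k using T by (simp add: lead_coeff_power)
  then have lc: "lead_coeff (e i) = 1" for i
    by (simp add: e_def lead_coeff_mult degree_monom_eq)
  have dege: "degree (e i) = i" for i
    using \<open>T \<noteq> 0\<close> T by (simp add: e_def degree_mult_eq degree_monom_eq degree_power_eq monom_eq_0_iff)
  have lce: "coeff (e i) i = 1" for i using lc[of i] dege[of i] by simp
  define t where "t = root d \<theta>"
  have t: "0 < t" "t < 1" "t ^ d = \<theta>" using T \<theta> by (auto simp: t_def)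
  have \<theta>t: "\<theta> ^ (i div d) \<le> t ^ i / \<theta>" for i
    unfolding t_def by (rule power_div_le_root_power) (use T \<theta> in auto)
  \<comment> \<open>The two factors 1/\<theta> are the rounding losses for i and for j.\<close>
  define K where "K = C / \<theta> ^ 2"
  have K: "K \<ge> 0" using \<theta> by (simp add: K_def)
  have entry: "norm (coeff_functional b (e i * e j)) \<le> K * t ^ (i + j)" for i j
  proof -
    have "e i * e j = Polynomial.monom 1 (i mod d + j mod d) * T ^ (i div d + j div d)"
    proof -
      have "Polynomial.monom (1::complex) (i mod d + j mod d) = Polynomial.monom 1 (i mod d) * Polynomial.monom 1 (j mod d)"
        by (simp add: mult_monom)
      then show ?thesis by (simp add: e_def power_add mult_ac)
    qed
    moreover have "i mod d + j mod d < 2 * d"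
      using T mod_less_divisor[of d i] mod_less_divisor[of d j] by linarith
    ultimately have "norm (coeff_functional b (e i * e j)) \<le> C * \<theta> ^ (i div d + j div d)"
      using bound[of "i mod d + j mod d" "i div d + j div d"] by simp
    also have "\<dots> = C * (\<theta> ^ (i div d) * \<theta> ^ (j div d))" by (simp add: power_add)
    also have "\<dots> \<le> C * ((t ^ i / \<theta>) * (t ^ j / \<theta>))"
      using \<theta> t \<theta>t by (intro mult_left_mono mult_mono) auto
    also have "\<dots> = K * t ^ (i + j)" by (simp add: K_def power_add power2_eq_square)
    finally show ?thesis .
  qed
  have "(\<lambda>n. (K / t) * (of_nat n * t ^ n)) \<longlonglongrightarrow> (K / t) * 0"
    using t by (intro tendsto_intros powser_times_n_limit_0) auto
  then have "eventually (\<lambda>n. (K / t) * (of_nat n * t ^ n) < 1) sequentially"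
    by (intro order_tendstoD(2)) auto
  then obtain N where N: "\<And>n. n \<ge> N \<Longrightarrow> (K / t) * (of_nat n * t ^ n) < 1"
    by (auto simp: eventually_sequentially)
  from int have "\<forall>i. \<exists>a. b i = of_int a" by (auto elim: Ints_cases)
  then obtain a where a: "\<And>i. b i = of_int (a i)" by metis
  show ?thesis
  proof (rule that[of "max N 1"])
    fix n assume n: "n \<ge> max N 1"
    have "norm (Determinant.det (Matrix.mat n n (\<lambda>(i, j). b (i + j)))) =
      norm (Determinant.det (Matrix.mat n n (\<lambda>(i, j). coeff_functional b (e i * e j))))"
      by (simp add: det_hankel_change_basis[OF dege lce])
    also have "\<dots> \<le> (n * K * t ^ (n - 1)) ^ n"
      by (rule det_norm_bound) (use entry K t in auto)
    also have "\<dots> < 1"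
    proof -
      have "t ^ n = t * t ^ (n - 1)" using n by (cases n) auto
      then have "n * K * t ^ (n - 1) = (K / t) * (of_nat n * t ^ n)" using t by simp
      also have "\<dots> < 1" using N n by simp
      finally have "n * K * t ^ (n - 1) < 1" .
      then show ?thesis using K t n by (intro power_less_one_iff[THEN iffD2]) auto
    qed
    finally have lt: "norm (Determinant.det (Matrix.mat n n (\<lambda>(i, j). b (i + j)))) < 1" .
    have "Matrix.mat n n (\<lambda>(i, j). b (i + j)) = map_mat of_int (Matrix.mat n n (\<lambda>(i, j). a (i + j)))"
      by (rule eq_matI) (auto simp: a)
    then have eq: "Determinant.det (Matrix.mat n n (\<lambda>(i, j). b (i + j))) =
      of_int (Determinant.det (Matrix.mat n n (\<lambda>(i, j). a (i + j))))"
      by (simp only: of_int_hom.hom_det)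
    then show "Determinant.det (Matrix.mat n n (\<lambda>(i, j). b (i + j))) = 0"
      using lt by (simp only: eq norm_of_int) (simp flip: of_int_abs)
  qed
qed

lemma integer_coeffs_linear_recurrence:
  fixes B :: "complex fps"
  assumes U: "open U" "w \<in> U" "norm w = 1" "ball 0 1 \<subseteq> U" "g holomorphic_on U"
    and B: "fps_conv_radius B \<ge> 1" "\<And>z. z \<in> ball 0 1 \<Longrightarrow> g z = eval_fps B z"
    and int: "\<And>i. fps_nth B i \<in> \<int>"
  obtains P :: "complex poly" where "P \<noteq> 0" "\<And>j. (\<Sum>i\<le>degree P. coeff P i * fps_nth B (i + j)) = 0"
proof -
  obtain T :: "complex poly" and d :: nat and \<theta> C :: real
  where T: "d > 0" "degree T = d" "coeff T d = 1"
    "0 < \<theta>" "\<theta> < 1" "0 \<le> C"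
    "\<And>k l. l < 2 * d \<Longrightarrow> norm (coeff_functional (fps_nth B) (Polynomial.monom 1 l * T ^ k)) \<le> C * \<theta> ^ k"
    by (rule coeff_functional_geometric_decay[OF U B order.refl]) (assumption, rule that)
  obtain N0 where N0: "\<And>n. n \<ge> N0 \<Longrightarrow> Determinant.det (Matrix.mat n n (\<lambda>(i, j). fps_nth B (i + j))) = 0"
    using integer_hankel_det_vanishes[OF T int] by blast
  have "\<exists>P. P \<noteq> 0 \<and> degree P < n \<and> (\<forall>j<n. coeff_functional (fps_nth B) (Polynomial.monom 1 j * P) = 0)"
    if n: "n \<ge> max 1 N0" for n
  proof -
    define A where "A = Matrix.mat n n (\<lambda>(i, j). fps_nth B (i + j))"
    have car: "A \<in> carrier_mat n n" by (simp add: A_def)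
    have "Determinant.det A = 0" using N0 n by (simp add: A_def)
    then obtain v where v: "v \<in> carrier_vec n" "v \<noteq> 0\<^sub>v n" "A *\<^sub>v v = 0\<^sub>v n"
      using det_0_iff_vec_prod_zero[OF car] by blast
    \<comment> \<open>A null vector of the symmetric Hankel matrix, read as a coefficient list, is a
      polynomial on whose first n shifts the functional vanishes.\<close>
    define P where "P = (\<Sum>i<n. Polynomial.monom (vec_index v i) i)"
    have cP: "coeff P i = (if i < n then vec_index v i else 0)" for i
      by (simp add: P_def coeff_sum)
    obtain i where "i < n" "vec_index v i \<noteq> 0"
      using v(1,2) by (metis carrier_vecD eq_vecI index_zero_vec(1) index_zero_vec(2))
    then have "P \<noteq> 0" using cP[of i] by auto
    moreover have deg: "degree P \<le> n - 1" using n by (intro degree_le) (auto simp: cP)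
    moreover have "coeff_functional (fps_nth B) (Polynomial.monom 1 j * P) = 0" if "j < n" for j
    proof -
      have "coeff_functional (fps_nth B) (Polynomial.monom 1 j * P) = (\<Sum>i<n. vec_index v i * fps_nth B (i + j))"
        using n by (subst coeff_functional_shift[OF deg]) (auto simp: cP simp flip: lessThan_Suc_atMost intro!: sum.cong)
      also have "\<dots> = vec_index (A *\<^sub>v v) j"
        using that v(1) by (simp add: A_def scalar_prod_def atLeast0LessThan mult.commute add.commute)
      also have "\<dots> = 0" using v(3) that by simp
      finally show ?thesis .
    qed
    ultimately show ?thesis using n by (intro exI[of _ P]) auto
  qed
  then obtain P where "P \<noteq> 0" "\<And>j. coeff_functional (fps_nth B) (Polynomial.monom 1 j * P) = 0"
    using kernel_polynomial_of_finite_kernels[of "max 1 N0" "fps_nth B"] by blast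
  then show ?thesis
    using that[of P] by (simp add: coeff_functional_shift[OF order.refl])
qed

section \<open>Hadamard gaps\<close>

text \<open>Lowest exponents add up under multiplication; the bound a / m is kept as a pair of
  naturals to avoid fractions.\<close>

lemma coeff_power_low_zero:
  fixes T :: "complex poly"
  assumes "\<And>i. coeff T i \<noteq> 0 \<Longrightarrow> a \<le> i * m" "coeff (T ^ k) i \<noteq> 0"
  shows "k * a \<le> i * m"
  using assms(2)
proof (induction k arbitrary: i)
  case (Suc k)
  from Suc.prems have "(\<Sum>j\<le>i. coeff T j * coeff (T ^ k) (i - j)) \<noteq> 0"
    by (simp add: coeff_mult)
  then obtain j where j: "j \<le> i" "coeff T j * coeff (T ^ k) (i - j) \<noteq> 0"
    by (auto elim: sum.not_neutral_contains_not_neutral)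
  then have "a \<le> j * m" "k * a \<le> (i - j) * m" using assms(1) Suc.IH by auto
  then have "Suc k * a \<le> (j + (i - j)) * m" by (simp add: distrib_right)
  then show ?case using j(1) by simp
qed auto

text \<open>The hypothesis \<open>gap\<close> says that a nonzero coefficient at n excludes others
  at i with 1 - 1/m < i/n < 1. As z^l T^k of degree N has exponents only in that range and at N
  itself, the functional there is the single coefficient at N, which then decays
  geometrically.\<close>

lemma hadamard_gaps_no_continuation:
  fixes B :: "complex fps"
  assumes U: "open U" "w \<in> U" "norm w = 1" "ball 0 1 \<subseteq> U" "g holomorphic_on U"
    and B: "fps_conv_radius B \<ge> 1" "\<And>z. z \<in> ball 0 1 \<Longrightarrow> g z = eval_fps B z"
    and m: "m \<ge> 1"
    and gap: "\<And>n i. n \<ge> n0 \<Longrightarrow> fps_nth B n \<noteq> 0 \<Longrightarrow> i < n \<Longrightarrow> n * (m - 1) < i * m \<Longrightarrow> fps_nth B i = 0"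
  shows "fps_conv_radius B > 1"
proof -
  \<comment> \<open>T is taken for 2 m instead of m: its exponent bound is not strict, and the slack
    N/(2m) turns it into the strict inequality of \<open>gap\<close>.\<close>
  have "2 * m \<ge> 1" using m by simp
  obtain T :: "complex poly" and d :: nat and \<theta> C :: real
  where T: "d > 0" "degree T = d" "coeff T d = 1"
    "\<And>i. coeff T i \<noteq> 0 \<Longrightarrow> d * (2 * m - 1) \<le> i * (2 * m)"
    "0 < \<theta>" "\<theta> < 1" "0 \<le> C"
    "\<And>k l. l < 2 * d \<Longrightarrow> norm (coeff_functional (fps_nth B) (Polynomial.monom 1 l * T ^ k)) \<le> C * \<theta> ^ k"
    by (rule coeff_functional_geometric_decay[OF U B \<open>2 * m \<ge> 1\<close>]) (assumption, rule that)
  have "T \<noteq> 0" using T by auto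
  have bound: "norm (fps_nth B N) \<le> C * \<theta> ^ (N div d)" if N: "N \<ge> n0" for N
  proof (cases "fps_nth B N = 0")
    case False
    define k where "k = N div d"
    define l where "l = N mod d"
    have kl: "N = l + k * d" "l < d" using T(1) by (auto simp: k_def l_def)
    define h where "h = Polynomial.monom 1 l * T ^ k"
    have degh: "degree h = N"
      using \<open>T \<noteq> 0\<close> T kl by (simp add: h_def degree_mult_eq degree_monom_eq degree_power_eq monom_eq_0_iff)
    have "lead_coeff h = 1"
      using T by (simp add: h_def lead_coeff_mult lead_coeff_power degree_monom_eq)
    then have ch: "coeff h N = 1" by (simp add: degh)
    have zero: "coeff h i * fps_nth B i = 0" if i: "i < N" for i
    proof (cases "coeff h i = 0")
      case nz: False
      have "coeff h i = (if i < l then 0 else coeff (T ^ k) (i - l))"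
        by (simp add: h_def coeff_monom_mult)
      with nz have li: "l \<le> i" and "coeff (T ^ k) (i - l) \<noteq> 0" by (auto split: if_splits)
      then have "k * (d * (2 * m - 1)) \<le> (i - l) * (2 * m)"
        using coeff_power_low_zero[OF T(4)] by blast
      then have "l * (2 * m) + k * (d * (2 * m - 1)) \<le> (l + (i - l)) * (2 * m)"
        by (simp only: distrib_right add_left_mono)
      moreover have "N * (2 * m - 1) \<le> l * (2 * m) + k * (d * (2 * m - 1))"
        by (simp add: kl distrib_right mult.assoc) 
      ultimately have "N * (2 * m - 1) \<le> i * (2 * m)" using li by simp
      moreover have "N * (2 * m - 1) = 2 * (N * (m - 1)) + N"
        using m by (cases m) (auto simp: algebra_simps)
      ultimately have "2 * (N * (m - 1)) < 2 * (i * m)" using i by simp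
      then have "N * (m - 1) < i * m" by simp
      then show ?thesis using gap[OF N False i] by simp
    qed simp
    have "coeff_functional (fps_nth B) h = (\<Sum>i\<le>N. if i = N then fps_nth B N else 0)"
      unfolding coeff_functional_def degh using zero ch by (intro sum.cong) auto
    then have "fps_nth B N = coeff_functional (fps_nth B) h" by simp
    moreover have "norm (coeff_functional (fps_nth B) h) \<le> C * \<theta> ^ k"
      unfolding h_def by (rule T(8)) (use kl(2) in simp)
    ultimately show ?thesis unfolding k_def by metis
  qed (use T in simp)
  define t where "t = root d \<theta>"
  have t: "0 < t" "t < 1" using T by (auto simp: t_def)
  \<comment> \<open>Any x strictly between 1 and 1/t would do; this one gives t x =
    \<open>sqrt t\<close>.\<close>
  define x where "x = 1 / sqrt t"
  have x: "x > 1" using t by (simp add: x_def)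
  have tx: "t * x = sqrt t" using t by (simp add: x_def real_div_sqrt)
  have "summable (\<lambda>n. fps_nth B n * of_real x ^ n)"
  proof (rule summable_comparison_test)
    show "summable (\<lambda>n. C / \<theta> * sqrt t ^ n)"
      using t by (intro summable_mult summable_geometric) auto
    show "\<exists>N. \<forall>n\<ge>N. norm (fps_nth B n * of_real x ^ n) \<le> C / \<theta> * sqrt t ^ n"
    proof (intro exI[of _ n0] allI impI)
      fix n assume n: "n \<ge> n0"
      have "norm (fps_nth B n * of_real x ^ n) = norm (fps_nth B n) * x ^ n"
        using x by (simp add: norm_mult norm_power)
      also have "\<dots> \<le> (C * (t ^ n / \<theta>)) * x ^ n"
      proof (rule mult_right_mono)
        have "norm (fps_nth B n) \<le> C * \<theta> ^ (n div d)" by (rule bound[OF n])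
        also have "\<dots> \<le> C * (t ^ n / \<theta>)"
          unfolding t_def using T by (intro mult_left_mono power_div_le_root_power) auto
        finally show "norm (fps_nth B n) \<le> C * (t ^ n / \<theta>)" .
      qed (use x in simp)
      also have "\<dots> = C / \<theta> * sqrt t ^ n" unfolding tx[symmetric] by (simp add: power_mult_distrib)
      finally show "norm (fps_nth B n * of_real x ^ n) \<le> C / \<theta> * sqrt t ^ n" .
    qed
  qed
  then have "ereal (norm (complex_of_real x)) \<le> fps_conv_radius B"
    unfolding fps_conv_radius_def by (rule conv_radius_geI)
  moreover have "1 < ereal (norm (complex_of_real x))" using x by simp
  ultimately show ?thesis by (metis order.strict_trans2)
qed

section \<open>The S-part of power differences\<close>

definition prime_part :: "nat set \<Rightarrow> nat \<Rightarrow> nat" where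
  "prime_part T y = (\<Prod>p\<in>{p \<in> T. p dvd y}. p ^ multiplicity p y)"

lemma multiplicity_int_nat_abs:
  assumes "prime p"
  shows "multiplicity (int p) x = multiplicity p (nat \<bar>x\<bar>)"
proof (cases "x = 0")
  case False
  have iff: "int p ^ k dvd x \<longleftrightarrow> p ^ k dvd nat \<bar>x\<bar>" for k
    by (metis int_dvd_int_iff abs_dvd_iff dvd_abs_iff of_nat_power nat_0_le abs_ge_zero)
  have y: "nat \<bar>x\<bar> \<noteq> 0" "\<not> is_unit p" using False assms by auto
  show ?thesis
  proof (rule multiplicity_eqI)
    show "int p ^ multiplicity p (nat \<bar>x\<bar>) dvd x" by (simp only: iff multiplicity_dvd)
    show "\<not> int p ^ Suc (multiplicity p (nat \<bar>x\<bar>)) dvd x"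
      unfolding iff using power_dvd_iff_le_multiplicity[OF y, of "Suc (multiplicity p (nat \<bar>x\<bar>))"] by simp
  qed
qed simp

text \<open>Replaces an index set that depends on y by a common one, so that products for different
  numbers can be compared factor by factor.\<close>

lemma prime_part_eq:
  assumes "y \<noteq> 0" "\<And>p. p \<in> T \<Longrightarrow> prime p" "y \<le> N"
  shows "prime_part T y = (\<Prod>p\<in>{p \<in> T. p \<le> N}. p ^ multiplicity p y)"
  unfolding prime_part_def
proof (rule prod.mono_neutral_left)
  show "{p \<in> T. p dvd y} \<subseteq> {p \<in> T. p \<le> N}"
    using assms by (auto dest!: dvd_imp_le)
qed (auto simp: not_dvd_imp_multiplicity_0)

lemma prime_part_primes:
  assumes "y \<noteq> 0"
  shows "prime_part {p. prime p} y = y"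
proof -
  have "{p \<in> {p. prime p}. p dvd y} = prime_factors y"
    using assms by (auto simp: prime_factors_dvd)
  then show ?thesis using prod_prime_factors[OF assms] by (simp add: prime_part_def)
qed

lemma prime_part_le:
  assumes "y \<noteq> 0" "\<And>p. p \<in> T \<Longrightarrow> prime p"
  shows "prime_part T y \<le> y" "prime_part T y \<ge> 1"
proof -
  have fin: "finite {p \<in> U. p dvd y}" for U using assms by simp
  have "prime_part T y dvd prime_part {p. prime p} y"
    unfolding prime_part_def by (rule prod_dvd_prod_subset) (use assms fin in auto)
  then show "prime_part T y \<le> y" using assms by (simp add: prime_part_primes dvd_imp_le)
  show "prime_part T y \<ge> 1"
    unfolding prime_part_def by (rule prod_ge_1) (use assms in \<open>auto simp: prime_gt_0_nat Suc_le_eq\<close>)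
qed

lemma int_euler_theorem:
  assumes "coprime a (int N)" "N > 0"
  shows "[a ^ totient N = 1] (mod int N)"
proof -
  define a' where "a' = nat (a mod int N)"
  have a': "int a' = a mod int N" using assms by (simp add: a'_def)
  have "coprime (int a') (int N)"
    unfolding a' using assms by (metis coprime_mod_left_iff of_nat_0_less_iff less_irrefl)
  then have "[a' ^ totient N = 1] (mod N)" by (intro euler_theorem) simp
  then have "[int a' ^ totient N = 1] (mod int N)"
    by (metis cong_int_iff of_nat_1 of_nat_power)
  moreover have "[a ^ totient N = int a' ^ totient N] (mod int N)"
    by (intro cong_pow) (simp add: a' cong_def)
  ultimately show ?thesis using cong_trans by blast
qed

text \<open>Numerator y and denominator z both factor over the primes up to N. The factors in S
  cancel against the p-adic values, and outside S the denominator contributes nothing because those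
  primes do not divide b.\<close>

lemma f_S_eq_prime_part:
  fixes r :: rat
  assumes q: "quotient_of r = (a, b)" and n: "n \<ge> 1" "a ^ n \<noteq> b ^ n"
    and S: "\<And>p. p \<in> S \<Longrightarrow> prime p"
    and nd: "\<And>p. prime p \<Longrightarrow> p \<notin> S \<Longrightarrow> \<not> int p dvd b"
  shows "f_S r S n = prime_part {p. prime p \<and> p \<notin> S} (nat \<bar>a ^ n - b ^ n\<bar>)"
proof -
  define T where "T = {p. prime p \<and> p \<notin> S}"
  define x where "x = a ^ n - b ^ n"
  define y where "y = nat \<bar>x\<bar>"
  define z where "z = nat (b ^ n)"
  have b: "b > 0" and cop: "coprime a b" and r: "r = of_int a / of_int b"
    using q quotient_of_denom_pos quotient_of_coprime quotient_of_div by blast+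
  have x0: "x \<noteq> 0" using n by (simp add: x_def)
  have y0: "y \<noteq> 0" using x0 by (simp add: y_def)
  have z0: "z \<noteq> 0" using b by (simp add: z_def not_le)
  have rx: "r ^ n - 1 = of_int x / of_int (b ^ n)"
    using b by (simp add: r x_def power_divide field_simps)
  have "gcd x (b ^ n) = gcd (a ^ n) (b ^ n)" by (simp add: x_def gcd_diff1)
  also have "\<dots> = 1" using cop by simp
  finally have "coprime x (b ^ n)" by (simp add: coprime_iff_gcd_eq_1)
  then have qx: "quotient_of (r ^ n - 1) = (x, b ^ n)"
    unfolding rx Fract_of_int_quotient[symmetric] quotient_of_Fract using b by (intro normalize_stable) auto
  have rn: "r ^ n - 1 \<noteq> 0" using x0 b by (simp add: rx)
  have pad: "padic_abs p (r ^ n - 1) = real p powi (int (multiplicity p z) - int (multiplicity p y))"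
    if "prime p" for p
    using rn that b by (simp add: padic_abs_def qx multiplicity_int_nat_abs y_def z_def)
  have abs: "real_of_rat \<bar>r ^ n - 1\<bar> = real y / real z"
    using b by (simp add: rx y_def z_def of_rat_divide abs_divide of_rat_power flip: of_int_abs)
  \<comment> \<open>Once N reaches y and z, all primes dividing either of them are present, so the
    partial products are constant from there on.\<close>
  have key: "real y / real z * (\<Prod>p\<in>{p \<in> S. p \<le> N}. padic_abs p (r ^ n - 1)) = real (prime_part T y)"
    if N: "N \<ge> max y z" for N
  proof -
    let ?e = "\<lambda>p. real p powi (int (multiplicity p y) - int (multiplicity p z))"
    have fin: "finite {p \<in> X. p \<le> N}" for X :: "nat set" by simp
    have "real y = (\<Prod>p\<in>{p \<in> {p. prime p}. p \<le> N}. real p ^ multiplicity p y)"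
      using prime_part_eq[OF y0, of "{p. prime p}" N] prime_part_primes[OF y0] N by (simp flip: of_nat_prod of_nat_power)
    moreover have "real z = (\<Prod>p\<in>{p \<in> {p. prime p}. p \<le> N}. real p ^ multiplicity p z)"
      using prime_part_eq[OF z0, of "{p. prime p}" N] prime_part_primes[OF z0] N by (simp flip: of_nat_prod of_nat_power)
    ultimately have "real y / real z = (\<Prod>p\<in>{p \<in> {p. prime p}. p \<le> N}. real p ^ multiplicity p y / real p ^ multiplicity p z)"
      by (simp add: prod_dividef)
    also have "\<dots> = (\<Prod>p\<in>{p \<in> {p. prime p}. p \<le> N}. ?e p)"
      by (intro prod.cong) (auto simp: power_int_diff)
    also have "{p \<in> {p. prime p}. p \<le> N} = {p \<in> S. p \<le> N} \<union> {p \<in> T. p \<le> N}"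
      using S by (auto simp: T_def)
    also have "(\<Prod>p\<in>\<dots>. ?e p) = (\<Prod>p\<in>{p \<in> S. p \<le> N}. ?e p) * (\<Prod>p\<in>{p \<in> T. p \<le> N}. ?e p)"
      by (rule prod.union_disjoint) (auto simp: T_def)
    also have "(\<Prod>p\<in>{p \<in> T. p \<le> N}. ?e p) = (\<Prod>p\<in>{p \<in> T. p \<le> N}. real p ^ multiplicity p y)"
    proof (rule prod.cong[OF refl])
      fix p assume "p \<in> {p \<in> T. p \<le> N}"
      then have p: "prime p" "\<not> int p dvd b" using nd by (auto simp: T_def)
      then have "\<not> int p dvd b ^ n" using prime_dvd_power_int by auto
      then have "multiplicity (int p) (b ^ n) = 0" by (rule not_dvd_imp_multiplicity_0)
      then have "multiplicity p z = 0" using b p by (simp add: multiplicity_int_nat_abs z_def)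
      then show "?e p = real p ^ multiplicity p y" by simp
    qed
    also have "\<dots> = real (prime_part T y)"
      using prime_part_eq[OF y0, of T N] N by (simp add: T_def)
    finally have "real y / real z * (\<Prod>p\<in>{p \<in> S. p \<le> N}. padic_abs p (r ^ n - 1)) =
        ((\<Prod>p\<in>{p \<in> S. p \<le> N}. ?e p) * (\<Prod>p\<in>{p \<in> S. p \<le> N}. padic_abs p (r ^ n - 1))) * real (prime_part T y)"
      by simp
    also have "(\<Prod>p\<in>{p \<in> S. p \<le> N}. ?e p) * (\<Prod>p\<in>{p \<in> S. p \<le> N}. padic_abs p (r ^ n - 1)) = 1"
      unfolding prod.distrib[symmetric]
    proof (rule prod.neutral, safe)
      fix p assume "p \<in> S"
      then have "prime p" by (rule S)
      then show "?e p * padic_abs p (r ^ n - 1) = 1"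
        by (simp add: pad prime_gt_0_nat flip: power_int_add)
    qed
    finally show ?thesis by simp
  qed
  have "(\<lambda>N. \<Prod>p\<in>{p \<in> S. p \<le> N}. padic_abs p (r ^ n - 1)) \<longlonglongrightarrow> real (prime_part T y) * real z / real y"
  proof (rule tendsto_eventually)
    show "\<forall>\<^sub>F N in sequentially. (\<Prod>p\<in>{p \<in> S. p \<le> N}. padic_abs p (r ^ n - 1)) = real (prime_part T y) * real z / real y"
      using eventually_ge_at_top[of "max y z"]
    proof eventually_elim
      case (elim N)
      show ?case using key[OF elim] y0 z0 by (simp add: field_simps)
    qed
  qed
  then have "S_abs S (r ^ n - 1) = real (prime_part T y) * real z / real y"
    unfolding S_abs_def by (rule limI)
  then have "f_S r S n = real y / real z * (real (prime_part T y) * real z / real y)"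
    unfolding f_S_def abs by simp
  also have "\<dots> = real (prime_part T y)" using y0 z0 by simp
  finally show ?thesis by (simp only: T_def y_def x_def)
qed

subsection \<open>Lifting the exponent\<close>

lemma power_add_first_order:
  fixes z d :: int
  shows "\<exists>c. (z + d) ^ Suc i = z ^ Suc i + int (Suc i) * d * z ^ i + d\<^sup>2 * c"
proof (induction i)
  case (Suc i)
  then obtain c where c: "(z + d) ^ Suc i = z ^ Suc i + int (Suc i) * d * z ^ i + d\<^sup>2 * c" by blast
  have "(z + d) ^ Suc (Suc i) = (z + d) * (z + d) ^ Suc i" by simp
  also have "\<dots> = z ^ Suc (Suc i) + int (Suc (Suc i)) * d * z ^ Suc i + d\<^sup>2 * (int (Suc i) * z ^ i + (z + d) * c)"
    unfolding c by (simp add: power2_eq_square algebra_simps)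
  finally show ?case by blast
qed (auto intro: exI[of _ 0])

text \<open>The cofactor Q is congruent to p z^(p-1) modulo p^2, hence divisible by p exactly once.
  For odd p the first-order terms in y - z carry the factor p (p - 1) / 2 and vanish modulo p^2; for
  p = 2, Q is 2 z + (y - z) and the divisibility by 4 is what makes this work.\<close>

lemma multiplicity_power_diff_prime:
  fixes y z :: int
  assumes p: "prime p" and d: "int p dvd y - z" "p = 2 \<Longrightarrow> 4 dvd y - z" "\<not> int p dvd z" and ne: "y \<noteq> z"
  shows "multiplicity (int p) (y ^ p - z ^ p) = Suc (multiplicity (int p) (y - z))"
proof -
  define Q where "Q = (\<Sum>i<p. z ^ (p - Suc i) * y ^ i)"
  have fact: "y ^ p - z ^ p = (y - z) * Q"
    unfolding Q_def by (rule power_diff_sumr2)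
  have pp: "prime (int p)" using p by simp
  have nz: "\<not> int p dvd z ^ (p - 1)" using pp d(3) prime_dvd_power by blast
  have Qmod: "[Q = int p * z ^ (p - 1)] (mod (int p)\<^sup>2)"
  proof (cases "p = 2")
    case True
    have "Q = 2 * z + (y - z)" by (simp add: Q_def True eval_nat_numeral)
    moreover have "(int p)\<^sup>2 dvd y - z" using d(2) True by simp
    ultimately show ?thesis using True by (simp add: cong_iff_dvd_diff)
  next
    case False
    then have "p > 2" using p prime_ge_2_nat[of p] by simp
    then have odd: "odd p" using p prime_odd_nat by blast
    obtain d' where d': "y - z = int p * d'" using d(1) by auto
    have term_mod: "[z ^ (p - Suc i) * y ^ i = z ^ (p - 1) + int i * (int p * d' * z ^ (p - 2))] (mod (int p)\<^sup>2)"
      if "i < p" for i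
    proof (cases i)
      case (Suc j)
      obtain c where c: "(z + int p * d') ^ Suc j = z ^ Suc j + int (Suc j) * (int p * d') * z ^ j + (int p * d')\<^sup>2 * c"
        using power_add_first_order by blast
      have "y = z + int p * d'" using d' by simp
      then have "z ^ (p - Suc i) * y ^ i = z ^ (p - Suc i) * z ^ Suc j + int i * (int p * d' * (z ^ (p - Suc i) * z ^ j))
          + (int p)\<^sup>2 * (z ^ (p - Suc i) * d'\<^sup>2 * c)"
        using c Suc by (simp add: power_mult_distrib algebra_simps)
      also have "z ^ (p - Suc i) * z ^ Suc j = z ^ (p - 1)"
      proof -
        have "p - Suc i + Suc j = p - 1" using that Suc by simp
        then show ?thesis by (metis power_add)
      qed
      also have "z ^ (p - Suc i) * z ^ j = z ^ (p - 2)"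
      proof -
        have "p - Suc i + j = p - 2" using that Suc by simp
        then show ?thesis by (metis power_add)
      qed
      finally show ?thesis by (simp add: cong_iff_dvd_diff)
    qed simp
    have "[Q = (\<Sum>i<p. z ^ (p - 1) + int i * (int p * d' * z ^ (p - 2)))] (mod (int p)\<^sup>2)"
      unfolding Q_def by (rule cong_sum) (use term_mod in auto)
    also have "(\<Sum>i<p. z ^ (p - 1) + int i * (int p * d' * z ^ (p - 2))) =
        int p * z ^ (p - 1) + (\<Sum>i<p. int i) * (int p * d' * z ^ (p - 2))"
      by (simp add: sum.distrib sum_distrib_right)
    also have "(\<Sum>i<p. int i) = int p * int ((p - 1) div 2)"
    proof -
      obtain k where k: "p = 2 * k + 1" using odd by (auto elim: oddE)
      have "(\<Sum>i<p. i) = p * ((p - 1) div 2)"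
        using Sum_Ico_nat[of 0 p] by (simp add: atLeast0LessThan k)
      from arg_cong[OF this, of int] show ?thesis by simp
    qed
    finally have "[Q = int p * z ^ (p - 1) + (int p)\<^sup>2 * (int ((p - 1) div 2) * d' * z ^ (p - 2))] (mod (int p)\<^sup>2)"
      by (simp add: power2_eq_square mult_ac)
    then show ?thesis unfolding cong_def by (simp only: mod_mult_self2)
  qed
  have "int p dvd Q"
  proof -
    have "(int p) dvd (int p)\<^sup>2" by (simp add: power2_eq_square)
    then have "[Q = int p * z ^ (p - 1)] (mod int p)" using Qmod cong_dvd_modulus by blast
    then show ?thesis by (simp add: cong_dvd_iff)
  qed
  moreover have "\<not> int p ^ Suc 1 dvd Q"
  proof
    assume "int p ^ Suc 1 dvd Q"
    then have "(int p)\<^sup>2 dvd int p * z ^ (p - 1)"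
      using Qmod cong_dvd_iff by (metis Suc_1)
    then have "int p dvd z ^ (p - 1)" using p by (simp add: power2_eq_square prime_gt_0_nat)
    then show False using nz by simp
  qed
  ultimately have "multiplicity (int p) Q = 1" by (intro multiplicity_eqI) auto
  moreover have "Q \<noteq> 0" using \<open>\<not> int p ^ Suc 1 dvd Q\<close> by auto
  ultimately show ?thesis
    using ne pp by (simp add: fact prime_elem_multiplicity_mult_distrib)
qed

lemma base_dvd_power_diff: "(y::int) - z dvd y ^ n - z ^ n"
  by (simp add: power_diff_sumr2)

text \<open>If p does not divide j, the cofactor is j z^(j-1) modulo p, which is nonzero. Otherwise
  one factor p is moved from the exponent into the bases, which is why the induction generalizes
  over y and z.\<close>

lemma multiplicity_power_diff:
  fixes y z :: int
  assumes p: "prime p" and "int p dvd y - z" "p = 2 \<Longrightarrow> 4 dvd y - z" "\<not> int p dvd z" "j \<ge> 1" "y ^ j \<noteq> z ^ j"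
  shows "multiplicity (int p) (y ^ j - z ^ j) = multiplicity (int p) (y - z) + multiplicity p j"
  using assms(2-)
proof (induction j arbitrary: y z rule: less_induct)
  case (less j)
  have pp: "prime (int p)" using p by simp
  have ne: "y \<noteq> z" using less.prems by auto
  show ?case
  proof (cases "p dvd j")
    case False
    define Q where "Q = (\<Sum>i<j. z ^ (j - Suc i) * y ^ i)"
    have fact: "y ^ j - z ^ j = (y - z) * Q"
      unfolding Q_def by (rule power_diff_sumr2)
    have yz: "[y = z] (mod int p)" using less.prems by (simp add: cong_iff_dvd_diff)
    have "[Q = (\<Sum>i<j. z ^ (j - Suc i) * z ^ i)] (mod int p)"
      unfolding Q_def by (intro cong_sum cong_mult cong_pow yz) auto
    also have "(\<Sum>i<j. z ^ (j - Suc i) * z ^ i) = (\<Sum>i<j. z ^ (j - 1))"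
      by (intro sum.cong) (auto simp flip: power_add)
    finally have "[Q = int j * z ^ (j - 1)] (mod int p)" by simp
    moreover have "\<not> int p dvd int j * z ^ (j - 1)"
      using pp False less.prems prime_dvd_mult_iff[OF pp] prime_dvd_power[OF pp] by auto
    ultimately have Q: "\<not> int p dvd Q" using cong_dvd_iff by blast
    then have "Q \<noteq> 0" by auto
    then show ?thesis
      using ne pp Q False by (simp add: fact prime_elem_multiplicity_mult_distrib not_dvd_imp_multiplicity_0)
  next
    case True
    then obtain i where i: "j = p * i" by auto
    have i1: "i \<ge> 1" "i < j" using less.prems i prime_gt_1_nat[OF p] by (auto intro: Suc_leI gr0I)
    have d1: "y - z dvd y ^ p - z ^ p" by (rule base_dvd_power_diff)
    have "multiplicity (int p) ((y ^ p) ^ i - (z ^ p) ^ i) = multiplicity (int p) (y ^ p - z ^ p) + multiplicity p i"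
      by (rule less.IH) (use less.prems i i1 d1 dvd_trans prime_dvd_power[OF pp] in \<open>auto simp flip: power_mult\<close>)
    moreover have "multiplicity (int p) (y ^ p - z ^ p) = Suc (multiplicity (int p) (y - z))"
      by (rule multiplicity_power_diff_prime) (use p less.prems ne in auto)
    moreover have "multiplicity p j = Suc (multiplicity p i)"
      using i i1 p by (simp add: multiplicity_times_same prime_gt_0_nat)
    ultimately show ?thesis by (simp add: i power_mult)
  qed
qed

section \<open>Periods and size of the T-part of a^n - b^n\<close>

locale sparse_power_diff =
  fixes a b :: int and T :: "nat set"
  assumes ne: "\<And>n. n \<ge> 1 \<Longrightarrow> a ^ n \<noteq> b ^ n"
    and T_prime: "\<And>p. p \<in> T \<Longrightarrow> prime p"
    and T_coprime: "\<And>p. p \<in> T \<Longrightarrow> \<not> int p dvd a" "\<And>p. p \<in> T \<Longrightarrow> \<not> int p dvd b"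
    and T_infinite: "infinite T"
    and T_sparse: "filterlim (\<lambda>n. ln (real (enumerate T (Suc n))) / real (enumerate T n)) at_top sequentially"
begin

(* e k and M k are the p_(k+1) and m_(k+1) of the introduction. *)
definition y :: "nat \<Rightarrow> nat" where "y n = nat \<bar>a ^ n - b ^ n\<bar>"
definition f :: "nat \<Rightarrow> nat" where "f n = prime_part T (y n)"
definition H :: nat where "H = nat (\<bar>a\<bar> + \<bar>b\<bar>)"
definition per :: "nat \<Rightarrow> nat" where "per p = (LEAST m. m \<ge> 1 \<and> int p dvd a ^ m - b ^ m)"
definition e :: "nat \<Rightarrow> nat" where "e k = enumerate T k"
definition M :: "nat \<Rightarrow> nat" where "M k = per (e k)"

lemma y_nz: "n \<ge> 1 \<Longrightarrow> y n \<noteq> 0"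
  using ne[of n] by (simp add: y_def)

lemma y_le:
  assumes "n \<ge> 1" shows "y n \<le> H ^ n"
proof -
  have "\<bar>a\<bar> ^ n + \<bar>b\<bar> ^ n \<le> (\<bar>a\<bar> + \<bar>b\<bar>) ^ n"
    using assms
  proof (induction n rule: dec_induct)
    case (step n)
    have "\<bar>a\<bar> ^ Suc n + \<bar>b\<bar> ^ Suc n \<le> (\<bar>a\<bar> + \<bar>b\<bar>) * (\<bar>a\<bar> ^ n + \<bar>b\<bar> ^ n)"
      by (simp add: algebra_simps)
    also have "\<dots> \<le> (\<bar>a\<bar> + \<bar>b\<bar>) * (\<bar>a\<bar> + \<bar>b\<bar>) ^ n"
      using step by (intro mult_left_mono) auto
    finally show ?case by simp
  qed simp
  moreover have "\<bar>a ^ n - b ^ n\<bar> \<le> \<bar>a\<bar> ^ n + \<bar>b\<bar> ^ n"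
    using abs_triangle_ineq4[of "a ^ n" "b ^ n"] by (simp add: power_abs)
  ultimately have "int (y n) \<le> int (H ^ n)" by (simp add: y_def H_def)
  then show ?thesis by (simp only: of_nat_le_iff)
qed

lemma f_le: "n \<ge> 1 \<Longrightarrow> f n \<le> H ^ n" and f_ge: "n \<ge> 1 \<Longrightarrow> f n \<ge> 1"
  using prime_part_le[OF y_nz T_prime] y_le[of n] by (auto simp: f_def intro: order_trans)

lemma p_dvd_y: "p dvd y n \<longleftrightarrow> int p dvd a ^ n - b ^ n"
  by (metis y_def int_dvd_int_iff abs_dvd_iff dvd_abs_iff nat_0_le abs_ge_zero)

lemma power_cong_one:
  assumes "p \<in> T" "totient (p ^ B) dvd n"
  shows "[a ^ n = 1] (mod int p ^ B)" "[b ^ n = 1] (mod int p ^ B)"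
proof -
  have *: "[c ^ n = 1] (mod int p ^ B)" if "\<not> int p dvd c" for c
  proof -
    have "coprime c (int p)"
      using that T_prime[OF assms(1)] prime_imp_coprime[of "int p" c] by (simp add: coprime_commute)
    then have "[c ^ totient (p ^ B) = 1] (mod int (p ^ B))"
      using T_prime[OF assms(1)] by (intro int_euler_theorem) (auto simp: prime_gt_0_nat)
    moreover obtain q where "n = totient (p ^ B) * q" using assms(2) by blast
    ultimately show ?thesis using cong_pow[of "c ^ totient (p ^ B)" 1 "int (p ^ B)" q] by (simp add: power_mult)
  qed
  show "[a ^ n = 1] (mod int p ^ B)" "[b ^ n = 1] (mod int p ^ B)"
    using * T_coprime[OF assms(1)] by auto
qed

lemma per:
  assumes "p \<in> T"
  shows "per p \<ge> 1" "int p dvd a ^ per p - b ^ per p" "per p < p"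
proof -
  have p: "prime p" using assms T_prime by simp
  define P where "P m \<longleftrightarrow> m \<ge> 1 \<and> int p dvd a ^ m - b ^ m" for m
  have "[a ^ (p - 1) = 1] (mod int p)" "[b ^ (p - 1) = 1] (mod int p)"
    using power_cong_one[OF assms, of 1 "p - 1"] p by (auto simp: totient_prime)
  then have "[a ^ (p - 1) = b ^ (p - 1)] (mod int p)" using cong_trans cong_sym by blast
  then have P: "P (p - 1)" using prime_ge_2_nat[OF p] by (simp add: P_def cong_iff_dvd_diff)
  have "per p = (LEAST m. P m)" by (simp add: per_def P_def)
  then have "P (per p)" "per p \<le> p - 1" using LeastI[of P, OF P] Least_le[of P, OF P] by auto
  then show "per p \<ge> 1" "int p dvd a ^ per p - b ^ per p" "per p < p"
    using prime_ge_2_nat[OF p] by (auto simp: P_def)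
qed

lemma per_dvd_iff:
  assumes "p \<in> T"
  shows "p dvd y n \<longleftrightarrow> per p dvd n"
proof
  have pp: "prime (int p)" using assms T_prime by simp
  have mult: "int p dvd a ^ (per p * q) - b ^ (per p * q)" for q
    using per(2)[OF assms] base_dvd_power_diff[of "a ^ per p" "b ^ per p" q]
    by (simp add: power_mult dvd_trans)
  {
    assume "per p dvd n"
    then show "p dvd y n" using mult by (auto simp: p_dvd_y)
  next
    assume "p dvd y n"
    define q s where "q = n div per p" and "s = n mod per p"
    have n: "n = per p * q + s" by (simp add: q_def s_def)
    \<comment> \<open>Division with remainder: p divides the second summand, so it divides a^s -
      b^s, and minimality of the period leaves only s = 0.\<close>
    have "a ^ n - b ^ n = a ^ (per p * q) * (a ^ s - b ^ s) + b ^ s * (a ^ (per p * q) - b ^ (per p * q))"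
      unfolding n power_add by (simp add: algebra_simps)
    then have "int p dvd a ^ (per p * q) * (a ^ s - b ^ s)"
      using \<open>p dvd y n\<close> mult[of q] by (metis p_dvd_y dvd_add_left_iff dvd_mult)
    then have "int p dvd a ^ (per p * q) \<or> int p dvd a ^ s - b ^ s"
      using pp prime_dvd_mult_iff by blast
    then have "int p dvd a ^ s - b ^ s"
      using T_coprime(1)[OF assms] prime_dvd_power[OF pp] by blast
    moreover have "s < per p" using per(1)[OF assms] by (simp add: s_def)
    ultimately have "\<not> s \<ge> 1" unfolding per_def using not_less_Least by blast
    then have "n mod per p = 0" by (simp add: s_def)
    then show "per p dvd n" by (rule mod_0_imp_dvd)
  }
qed

text \<open>A period is at least logarithmic in its prime. This is the only way in which the
  sparsity of T is transferred to its periods.\<close>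

lemma le_H_power_per: "p \<in> T \<Longrightarrow> p \<le> H ^ per p"
  using per[of p] per_dvd_iff[of p "per p"] y_nz[of "per p"] y_le[of "per p"]
  by (auto dest!: dvd_imp_le)

lemma H_pos: "H \<ge> 2"
proof -
  obtain p where "p \<in> T" using T_infinite by (metis finite.emptyI ex_in_conv)
  then have "a \<noteq> 0" "b \<noteq> 0" using T_coprime by auto
  then show ?thesis by (simp add: H_def)
qed

lemma multiplicity_y: "p \<in> T \<Longrightarrow> multiplicity p (y n) = multiplicity (int p) (a ^ n - b ^ n)"
  using multiplicity_int_nat_abs[OF T_prime] by (simp add: y_def)

lemma power_multiplicity_y_le: "p \<in> T \<Longrightarrow> m \<ge> 1 \<Longrightarrow> p ^ multiplicity p (y m) \<le> H ^ m"
  using y_nz[of m] y_le[of m] by (meson multiplicity_dvd dvd_imp_le not_gr_zero order_trans)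

(*
  For odd p the exponent per p would suffice; the factor 2 accounts for p = 2, where lifting the
  exponent starts from a^2 - b^2.
*)
lemma power_multiplicity_bound:
  assumes p: "p \<in> T" and n: "n \<ge> 1" "per p dvd n"
  shows "p ^ multiplicity p (y n) \<le> H ^ (2 * per p) * p ^ multiplicity p n"
proof -
  have pr: "prime p" and pp: "prime (int p)" using p T_prime by auto
  have base: "\<exists>m j. 1 \<le> m \<and> m \<le> 2 * per p \<and> j dvd n \<and> j \<ge> 1 \<and> multiplicity p (y n) \<le> multiplicity p (y m) + multiplicity p j"
  proof (cases "p = 2")
    case False
    define m where "m = per p"
    obtain j where j: "n = m * j" using n(2) by (auto simp: m_def)
    have "multiplicity (int p) ((a ^ m) ^ j - (b ^ m) ^ j) = multiplicity (int p) (a ^ m - b ^ m) + multiplicity p j"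
    proof (rule multiplicity_power_diff[OF pr])
      show "\<not> int p dvd b ^ m" using T_coprime(2)[OF p] prime_dvd_power[OF pp] by blast
      show "(a ^ m) ^ j \<noteq> (b ^ m) ^ j" using ne[OF n(1)] by (simp add: j power_mult)
    qed (use False per(2)[OF p] j n in \<open>auto simp: m_def Suc_le_eq intro: gr0I\<close>)
    then have "multiplicity p (y n) = multiplicity p (y m) + multiplicity p j"
      using p by (simp add: multiplicity_y j power_mult)
    then show ?thesis using per(1)[OF p] j n by (intro exI[of _ m] exI[of _ j]) (auto simp: m_def Suc_le_eq intro: gr0I)
  next
    case True
    have odd: "odd a" "odd b" using T_coprime[OF p] True by auto
    have four: "4 dvd a ^ 2 - b ^ 2"
    proof -
      have "a ^ 2 - b ^ 2 = (a - b) * (a + b)" by (simp add: power2_eq_square algebra_simps)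
      moreover have "2 * 2 dvd (a - b) * (a + b)" using odd by (intro mult_dvd_mono) auto
      ultimately show ?thesis by simp
    qed
    \<comment> \<open>n may be odd, so the exponent is lifted from 2 to 2 n and the result is
      compared with a^n - b^n, which divides a^(2n) - b^(2n).\<close>
    have "(a ^ 2) ^ n \<noteq> (b ^ 2) ^ n" using ne[of "2 * n"] n by (simp add: power_mult)
    then have "multiplicity (int p) ((a ^ 2) ^ n - (b ^ 2) ^ n) = multiplicity (int p) (a ^ 2 - b ^ 2) + multiplicity p n"
      using four odd True n dvd_trans[of 2 4 "a\<^sup>2 - b\<^sup>2"] by (intro multiplicity_power_diff[OF pr]) auto
    moreover have "multiplicity (int p) (a ^ n - b ^ n) \<le> multiplicity (int p) ((a ^ 2) ^ n - (b ^ 2) ^ n)"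
    proof (rule dvd_imp_multiplicity_le)
      show "a ^ n - b ^ n dvd (a ^ 2) ^ n - (b ^ 2) ^ n"
        using base_dvd_power_diff[of "a ^ n" "b ^ n" 2] by (simp flip: power_mult add: mult.commute)
    qed (use \<open>(a ^ 2) ^ n \<noteq> (b ^ 2) ^ n\<close> pp in auto)
    ultimately have "multiplicity p (y n) \<le> multiplicity p (y 2) + multiplicity p n"
      using p by (simp add: multiplicity_y)
    then show ?thesis using n per(1)[OF p] by (intro exI[of _ 2] exI[of _ n]) auto
  qed
  then obtain m j where m: "1 \<le> m" "m \<le> 2 * per p" and j: "j dvd n" "j \<ge> 1"
    and le: "multiplicity p (y n) \<le> multiplicity p (y m) + multiplicity p j" by blast
  have "multiplicity p j \<le> multiplicity p n"
    using j n pr by (intro dvd_imp_multiplicity_le) auto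
  then have "p ^ multiplicity p (y n) \<le> p ^ (multiplicity p (y m) + multiplicity p n)"
    using le prime_gt_0_nat[OF pr] by (intro power_increasing) auto
  also have "\<dots> \<le> H ^ m * p ^ multiplicity p n"
    using power_multiplicity_y_le[OF p m(1)] by (simp add: power_add)
  also have "\<dots> \<le> H ^ (2 * per p) * p ^ multiplicity p n"
    using m H_pos by (intro mult_right_mono power_increasing) auto
  finally show ?thesis .
qed

lemma finite_periods: "n \<ge> 1 \<Longrightarrow> finite {p \<in> T. per p dvd n}"
  by (rule finite_subset[OF _ finite_divisors_nat[of "y n"]]) (use y_nz[of n] in \<open>auto simp: per_dvd_iff\<close>)

lemma f_eq: "f n = (\<Prod>p\<in>{p \<in> T. per p dvd n}. p ^ multiplicity p (y n))"
  unfolding f_def prime_part_def by (rule prod.cong) (auto simp: per_dvd_iff)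

text \<open>The parts of the prime powers that grow with n multiply to a divisor of n; what remains
  depends only on the periods.\<close>

lemma f_bound_sum:
  assumes "n \<ge> 1"
  shows "f n \<le> n * H ^ (2 * (\<Sum>p\<in>{p \<in> T. per p dvd n}. per p))"
proof -
  define A where "A = {p \<in> T. per p dvd n}"
  have "f n \<le> (\<Prod>p\<in>A. H ^ (2 * per p) * p ^ multiplicity p n)"
    unfolding f_eq A_def by (rule prod_mono) (use power_multiplicity_bound assms in auto)
  also have "\<dots> = (\<Prod>p\<in>A. p ^ multiplicity p n) * H ^ (2 * (\<Sum>p\<in>A. per p))"
    by (simp add: prod.distrib power_sum sum_distrib_left)
  also have "(\<Prod>p\<in>A. p ^ multiplicity p n) = prime_part A n"
    unfolding prime_part_def using finite_periods[OF assms]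
    by (intro prod.mono_neutral_right) (auto simp: A_def not_dvd_imp_multiplicity_0)
  also have "prime_part A n * H ^ (2 * (\<Sum>p\<in>A. per p)) \<le> n * H ^ (2 * (\<Sum>p\<in>A. per p))"
    using assms T_prime by (intro mult_right_mono prime_part_le) (auto simp: A_def)
  finally show ?thesis by (simp add: A_def)
qed

lemma e_in: "e k \<in> T" and e_mono: "k < l \<Longrightarrow> e k < e l" and e_mono_le: "k \<le> l \<Longrightarrow> e k \<le> e l"
  and e_surj: "p \<in> T \<Longrightarrow> \<exists>k. p = e k" and e_prime: "prime (e k)"
  and M_less: "M k < e k" and M_ge: "M k \<ge> 1"
proof -
  show in_T: "e k \<in> T" for k using T_infinite by (simp add: e_def enumerate_in_set)
  show mono: "e k < e l" if "k < l" for k l using T_infinite that by (simp add: e_def enumerate_mono)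
  show "e k \<le> e l" if "k \<le> l" for k l using mono[of k l] that by (cases "k = l") auto
  show "\<exists>k. p = e k" if "p \<in> T" using enumerate_Ex[OF T_infinite that] by (auto simp: e_def)
  show "prime (e k)" "M k < e k" "M k \<ge> 1" using in_T T_prime per by (auto simp: M_def)
qed

section \<open>From sparse primes to sparse large values\<close>

lemma eventually_ratio: "\<exists>k0. \<forall>k\<ge>k0. L * real (e k) \<le> ln (real (e (Suc k)))"
proof -
  have "eventually (\<lambda>k. L \<le> ln (real (e (Suc k))) / real (e k)) sequentially"
    using T_sparse by (simp add: filterlim_at_top e_def)
  then obtain k0 where "\<And>k. k \<ge> k0 \<Longrightarrow> L \<le> ln (real (e (Suc k))) / real (e k)"
    by (auto simp: eventually_sequentially)
  then show ?thesis using prime_gt_0_nat[OF e_prime] by (intro exI[of _ k0]) (auto simp: pos_le_divide_eq)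
qed

text \<open>For l = k + 1 this combines the logarithmic lower bound for periods with sparsity.
  Larger l reduce to it by monotonicity of e; M itself is not known to be monotone.\<close>

lemma M_growth: "\<exists>k0. \<forall>k\<ge>k0. \<forall>l>k. L * e k \<le> M l"
proof -
  have lnH: "ln (real H) > 0" using H_pos by simp
  obtain k0 where k0: "\<And>k. k \<ge> k0 \<Longrightarrow> (real L * ln (real H)) * real (e k) \<le> ln (real (e (Suc k)))"
    using eventually_ratio by blast
  have step: "L * e k \<le> M (Suc k)" if "k \<ge> k0" for k
  proof -
    have "real (e (Suc k)) \<le> real (H ^ M (Suc k))"
      using le_H_power_per[OF e_in[of "Suc k"]] by (simp add: M_def del: of_nat_power)
    then have "ln (real (e (Suc k))) \<le> ln (real (H ^ M (Suc k)))"
      using prime_gt_0_nat[OF e_prime[of "Suc k"]] by (intro ln_mono) auto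
    also have "\<dots> = real (M (Suc k)) * ln (real H)" using H_pos by (simp add: ln_realpow)
    finally have "(real L * real (e k)) * ln (real H) \<le> real (M (Suc k)) * ln (real H)"
      using k0[OF that] by (simp add: mult_ac)
    then have "real L * real (e k) \<le> real (M (Suc k))" using lnH by simp
    then show ?thesis by (simp flip: of_nat_mult)
  qed
  have "L * e k \<le> M l" if "k \<ge> k0" "l > k" for k l
  proof -
    have "L * e k \<le> L * e (l - 1)" using that by (intro mult_left_mono e_mono_le) auto
    also have "\<dots> \<le> M l" using step[of "l - 1"] that by simp
    finally show ?thesis .
  qed
  then show ?thesis by blast
qed

text \<open>The induction step is M k + e k < 2 e k <= M (k + 1), and C absorbs the initial segment.
  Thus all earlier periods together cost no more than the current one, up to a constant.\<close>

lemma sum_e_bound: "\<exists>C. \<forall>k. (\<Sum>j<k. e j) \<le> M k + C"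
proof -
  obtain k0 where k0: "\<And>k l. k \<ge> k0 \<Longrightarrow> l > k \<Longrightarrow> 2 * e k \<le> M l" using M_growth by blast
  define C where "C = (\<Sum>j<k0. e j)"
  have "(\<Sum>j<k. e j) \<le> M k + C" for k
  proof (cases "k \<le> k0")
    case True
    then have "(\<Sum>j<k. e j) \<le> C" unfolding C_def by (intro sum_mono2) auto
    then show ?thesis by simp
  next
    case False
    then have "k0 \<le> k" by simp
    then show ?thesis
    proof (induction k rule: dec_induct)
      case base
      then show ?case by (simp add: C_def)
    next
      case (step k)
      have "(\<Sum>j<Suc k. e j) \<le> M k + C + e k" using step.IH by simp
      also have "\<dots> \<le> 2 * e k + C" using M_less[of k] by simp
      also have "\<dots> \<le> M (Suc k) + C" using k0[of k "Suc k"] step.hyps by simp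
      finally show ?case .
    qed
  qed
  then show ?thesis by blast
qed

text \<open>k is the last index whose period divides n. The earlier periods add at most M k plus a
  constant, so the sum of periods is at most 2 M k plus a constant; doubling in the exponent of H
  yields 4 M k.\<close>

lemma f_bound: "\<exists>C. \<forall>n\<ge>1. f n = 1 \<or> (\<exists>k. M k dvd n \<and> f n \<le> C * n * H ^ (4 * M k))"
proof -
  obtain C0 where C0: "\<And>k. (\<Sum>j<k. e j) \<le> M k + C0" using sum_e_bound by blast
  have "f n = 1 \<or> (\<exists>k. M k dvd n \<and> f n \<le> H ^ (2 * C0) * n * H ^ (4 * M k))" if n: "n \<ge> 1" for n
  proof (cases "{p \<in> T. per p dvd n} = {}")
    case True
    have "f n = 1" unfolding f_eq True by simp
    then show ?thesis by blast
  next
    case False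
    define A where "A = {p \<in> T. per p dvd n}"
    have inj: "inj e" by (rule linorder_injI) (use e_mono in \<open>metis less_irrefl\<close>)
    define K where "K = {k. e k \<in> A}"
    have AK: "A = e ` K" using e_surj by (auto simp: K_def A_def)
    have "finite K" using finite_periods[OF n] inj AK by (metis A_def finite_imageD inj_on_subset subset_UNIV)
    moreover have "K \<noteq> {}" using False AK by (auto simp: A_def)
    ultimately have k: "Max K \<in> K" "\<And>j. j \<in> K \<Longrightarrow> j \<le> Max K" by auto
    define k where "k = Max K"
    have "M k dvd n" using k(1) by (simp add: K_def A_def M_def k_def)
    have "(\<Sum>p\<in>A. per p) = (\<Sum>j\<in>K. M j)"
      unfolding AK by (subst sum.reindex) (use inj inj_on_subset in \<open>auto simp: M_def\<close>)
    also have "\<dots> \<le> (\<Sum>j<Suc k. M j)"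
      using k(2) by (intro sum_mono2) (auto simp: k_def less_Suc_eq_le)
    also have "\<dots> = (\<Sum>j<k. M j) + M k" by simp
    also have "(\<Sum>j<k. M j) \<le> (\<Sum>j<k. e j)" using M_less by (intro sum_mono) (simp add: less_imp_le)
    also have "\<dots> \<le> M k + C0" by (rule C0)
    finally have s: "(\<Sum>p\<in>A. per p) \<le> 2 * M k + C0" by simp
    have "f n \<le> n * H ^ (2 * (\<Sum>p\<in>A. per p))" using f_bound_sum[OF n] by (simp add: A_def)
    also have "\<dots> \<le> n * H ^ (2 * C0 + 4 * M k)"
      using s H_pos by (intro mult_left_mono power_increasing) auto
    also have "\<dots> = H ^ (2 * C0) * n * H ^ (4 * M k)" by (simp add: power_add)
    finally show ?thesis using \<open>M k dvd n\<close> by blast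
  qed
  then show ?thesis by blast
qed

lemma large_values_have_large_period:
  fixes c :: real
  assumes c: "c > 1"
  shows "\<exists>J\<ge>1. \<exists>n1\<ge>1. \<forall>n\<ge>n1. c ^ n \<le> f n \<longrightarrow> (\<exists>k. M k dvd n \<and> n < J * M k)"
proof -
  obtain C where C: "\<And>n. n \<ge> 1 \<Longrightarrow> f n = 1 \<or> (\<exists>k. M k dvd n \<and> f n \<le> C * n * H ^ (4 * M k))"
    using f_bound by blast
  \<comment> \<open>c^n is split into two factors s^n: one absorbs C n for large n, the other
    absorbs H^(4 M k) once n is at least J M k.\<close>
  define s where "s = sqrt c"
  have s: "s > 1" "s * s = c" using c by (auto simp: s_def)
  obtain J where J: "real (H ^ 4) < s ^ J" using real_arch_pow[OF s(1)] by blast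
  have "J \<ge> 1" using J H_pos by (cases J) (auto simp: power_less_one_iff)
  have "(\<lambda>n. real C * (of_nat n * (1 / s) ^ n)) \<longlonglongrightarrow> real C * 0"
    using s by (intro tendsto_intros powser_times_n_limit_0) auto
  then have "eventually (\<lambda>n. real C * (of_nat n * (1 / s) ^ n) < 1) sequentially"
    by (intro order_tendstoD(2)) auto
  then obtain n0 where n0: "\<And>n. n \<ge> n0 \<Longrightarrow> real C * (real n * (1 / s) ^ n) < 1"
    by (auto simp: eventually_sequentially)
  have "\<exists>k. M k dvd n \<and> n < J * M k" if n: "n \<ge> max n0 1" "c ^ n \<le> f n" for n
  proof (rule ccontr)
    assume no: "\<nexists>k. M k dvd n \<and> n < J * M k"
    have "c ^ n > 1" using c n by (intro one_less_power) auto
    then have "f n \<noteq> 1" using n by auto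
    then obtain k where k: "M k dvd n" "f n \<le> C * n * H ^ (4 * M k)" using C n by auto
    then have "J * M k \<le> n" using no by auto
    have "real (H ^ (4 * M k)) = real (H ^ 4) ^ M k" by (simp add: power_mult)
    also have "\<dots> \<le> (s ^ J) ^ M k" using J by (intro power_mono) auto
    also have "\<dots> = s ^ (J * M k)" by (simp add: power_mult)
    also have "\<dots> \<le> s ^ n" using s \<open>J * M k \<le> n\<close> by (intro power_increasing) auto
    finally have Hs: "real (H ^ (4 * M k)) \<le> s ^ n" .
    have "real C * real n < s ^ n"
      using n0[of n] n s by (simp add: power_divide field_simps)
    have "real (f n) \<le> real C * real n * real (H ^ (4 * M k))"
      using k(2) by (metis of_nat_le_iff of_nat_mult)
    also have "\<dots> \<le> real C * real n * s ^ n" using Hs by (intro mult_left_mono) auto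
    also have "\<dots> < s ^ n * s ^ n" using \<open>real C * real n < s ^ n\<close> s by (intro mult_strict_right_mono) auto
    also have "\<dots> = c ^ n" by (simp flip: power_mult_distrib add: s)
    finally show False using n by simp
  qed
  then show ?thesis using \<open>J \<ge> 1\<close> by (intro exI[of _ J] conjI exI[of _ "max n0 1"]) auto
qed

(* Here n = j M k and i = j' M l with j, j' < J, and the M k grow faster than any geometric sequence. *)
lemma large_values_have_gaps:
  fixes c :: real
  assumes c: "c > 1"
  obtains m n0 where "m \<ge> 1"
    "\<And>n i. n \<ge> n0 \<Longrightarrow> c ^ n \<le> f n \<Longrightarrow> i < n \<Longrightarrow> n * (m - 1) < i * m \<Longrightarrow> f i < c ^ i"
proof -
  obtain J n1 where J: "J \<ge> 1" "n1 \<ge> 1"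
      "\<And>n. n \<ge> n1 \<Longrightarrow> c ^ n \<le> f n \<Longrightarrow> \<exists>k. M k dvd n \<and> n < J * M k"
    using large_values_have_large_period[OF c] by blast
  obtain k1 where k1: "\<And>k l. k \<ge> k1 \<Longrightarrow> l > k \<Longrightarrow> (2 * J) * e k \<le> M l"
    using M_growth by blast
  have sep: "2 * J * M k \<le> M l" if "k \<ge> k1" "l > k" for k l
  proof -
    have "2 * J * M k \<le> 2 * J * e k" using M_less[of k] by simp
    then show ?thesis using k1[OF that] by (rule order_trans)
  qed
  define X where "X = Max (M ` {..k1})"
  have X: "M k \<le> X" if "k \<le> k1" for k using that by (auto simp: X_def)
  show ?thesis
  \<comment> \<open>With m = 2 J the hypothesis on i reads n - i < n/(2J), in particular n < 2 i.
    The threshold for n then gives i >= n1 and forces both indices k and l beyond k1.\<close>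
  proof (rule that[of "2 * J" "2 * n1 + 2 * J * X"])
    show "2 * J \<ge> 1" using J by simp
    fix n i assume n: "n \<ge> 2 * n1 + 2 * J * X" "c ^ n \<le> f n" and i: "i < n" "n * (2 * J - 1) < i * (2 * J)"
    show "f i < c ^ i"
    proof (rule ccontr)
      assume "\<not> f i < c ^ i"
      then have fi: "c ^ i \<le> f i" by simp
      obtain j where Jj: "J = Suc j" using J(1) by (cases J) auto
      have "n * (2 * J) < i * (2 * J) + n" using i(2) by (simp add: Jj algebra_simps)
      moreover have "n \<le> n * J" using J(1) by simp
      ultimately have "n * (2 * J) < i * (2 * J) + n * J" by linarith
      then have "J * n < J * (2 * i)" by (simp add: algebra_simps)
      then have ni: "n < 2 * i" by simp
      obtain k where k: "M k dvd n" "n < J * M k" using J(3)[of n] n by auto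
      obtain l where l: "M l dvd i" "i < J * M l" using J(3)[of i] fi ni n(1) by auto
      have kk: "k > k1" 
      proof (rule ccontr)
        assume "\<not> k > k1"
        then have "J * M k \<le> J * X" using X[of k] by simp
        then show False using k(2) n(1) by linarith
      qed
      have ll: "l > k1"
      proof (rule ccontr)
        assume "\<not> l > k1"
        then have "J * M l \<le> J * X" using X[of l] by simp
        then show False using l(2) n(1) ni by linarith
      qed
      \<comment> \<open>If l = k, the difference n - i is a positive multiple of M k > n/J, too
        large. If l and k differ, the separation by 2 J puts n and i more than a factor 2 apart or
        in the wrong order.\<close>
      consider "l = k" | "l < k" | "l > k" by linarith
      then show False
      proof cases
        case 1
        have "M k dvd n - i" using k(1) l(1) 1 by (simp add: dvd_diff_nat)
        then have "M k \<le> n - i" using i by (simp add: dvd_imp_le)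
        then have "J * M k \<le> J * (n - i)" by (rule mult_le_mono2)
        then have "n < J * (n - i)" using k(2) by linarith
        then have "n + J * i < J * n" using i(1) by (simp add: diff_mult_distrib2)
        moreover have "n * (2 * J) < i * (2 * J) + n" by fact
        ultimately have "2 * n + 2 * (J * i) < 2 * (J * i) + n" by (simp add: algebra_simps)
        then show False by simp
      next
        case 2
        have "2 * J * M l \<le> M k" using sep 2 ll by simp
        then have "2 * i < M k" using l(2) by (simp add: mult.assoc)
        moreover have "M k \<le> n" using k(1) i(1) by (intro dvd_imp_le) auto
        ultimately show False using ni by linarith
      next
        case 3
        have "2 * J * M k \<le> M l" using sep 3 kk by simp
        then have "2 * n < M l" using k(2) by (simp add: mult.assoc)
        moreover have "M l \<le> i" using l(1) ni by (intro dvd_imp_le) auto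
        ultimately show False using i by linarith
      qed
    qed
  qed
qed

section \<open>Recurrence of the initial values\<close>

lemma e_square: "\<exists>k0. \<forall>k\<ge>k0. e k * e k \<le> e (Suc k)"
proof -
  obtain k0 where k0: "\<And>k. k \<ge> k0 \<Longrightarrow> 2 * real (e k) \<le> ln (real (e (Suc k)))"
    using eventually_ratio by blast
  have "e k * e k \<le> e (Suc k)" if "k \<ge> k0" for k
  proof -
    have pos: "real (e (Suc k)) > 0" using prime_gt_0_nat[OF e_prime] by simp
    have "real (e k) \<le> exp (real (e k))" using exp_ge_add_one_self[of "real (e k)"] by linarith
    then have "real (e k) * real (e k) \<le> exp (real (e k)) * exp (real (e k))"
      by (intro mult_mono) auto
    also have "\<dots> = exp (2 * real (e k))" by (simp flip: exp_add)
    also have "\<dots> \<le> exp (ln (real (e (Suc k))))" using k0[OF that] by simp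
    also have "\<dots> = real (e (Suc k))" using pos by simp
    finally show ?thesis by (simp flip: of_nat_mult)
  qed
  then show ?thesis by blast
qed

text \<open>Multiplicative counterpart of \<open>sum_e_bound\<close>, needed because a common
  multiple of all earlier periods must stay below the later ones.\<close>

lemma prod_e_bound: "\<exists>C k0. \<forall>k\<ge>k0. (\<Prod>j<k. e j) \<le> C * e k"
proof -
  obtain k0 where k0: "\<And>k. k \<ge> k0 \<Longrightarrow> e k * e k \<le> e (Suc k)" using e_square by blast
  define C where "C = (\<Prod>j<k0. e j)"
  have "(\<Prod>j<k. e j) \<le> C * e k" if "k \<ge> k0" for k
    using that
  proof (induction k rule: dec_induct)
    case base
    then show ?case using prime_gt_0_nat[OF e_prime] by (simp add: C_def Suc_le_eq)
  next
    case (step k)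
    have "(\<Prod>j<Suc k. e j) \<le> C * e k * e k" using step.IH by simp
    also have "\<dots> \<le> C * e (Suc k)" using k0 step.hyps by (simp add: mult.assoc)
    finally show ?case .
  qed
  then show ?thesis by blast
qed

text \<open>Both a^n and b^n are 1 modulo p^B, so the differences at n + i and at i agree modulo
  p^B. The strict bound by B lets this congruence see the power that no longer divides.\<close>

lemma multiplicity_y_shift:
  assumes p: "p \<in> T" and n: "totient (p ^ B) dvd n" and i: "i \<ge> 1" "multiplicity p (y i) < B"
  shows "multiplicity p (y (n + i)) = multiplicity p (y i)"
proof -
  have pr: "prime p" "p \<noteq> Suc 0" using T_prime[OF p] prime_gt_1_nat by auto
  define v where "v = multiplicity p (y i)"
  have "[a ^ (n + i) - b ^ (n + i) = 1 * a ^ i - 1 * b ^ i] (mod int p ^ B)"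
    unfolding power_add by (intro cong_diff cong_mult power_cong_one[OF p n] cong_refl)
  then have cong: "[a ^ (n + i) - b ^ (n + i) = a ^ i - b ^ i] (mod int p ^ k)" if "k \<le> B" for k
    using cong_dvd_modulus[OF _ le_imp_power_dvd[OF that]] by simp
  have v: "v = multiplicity (int p) (a ^ i - b ^ i)" using p by (simp add: v_def multiplicity_y)
  have "multiplicity (int p) (a ^ (n + i) - b ^ (n + i)) = v"
  proof (rule multiplicity_eqI)
    show "int p ^ v dvd a ^ (n + i) - b ^ (n + i)"
      using cong_dvd_iff[OF cong[of v]] i by (simp add: v_def[symmetric]) (simp add: v multiplicity_dvd)
    have "\<not> int p ^ Suc v dvd a ^ i - b ^ i"
      using power_dvd_iff_le_multiplicity[of "a ^ i - b ^ i" "int p" "Suc v"] ne[OF i(1)] pr by (simp add: v)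
    then show "\<not> int p ^ Suc v dvd a ^ (n + i) - b ^ (n + i)"
      using cong_dvd_iff[OF cong[of "Suc v"]] i by (simp add: v_def[symmetric])
  qed
  then show ?thesis using p by (simp add: v_def multiplicity_y)
qed

lemma f_cong:
  assumes "i \<ge> 1" "j \<ge> 1" "\<And>p. p \<in> T \<Longrightarrow> multiplicity p (y i) = multiplicity p (y j)"
  shows "f i = f j"
proof -
  have "f i = (\<Prod>p\<in>{p \<in> T. p \<le> max (y i) (y j)}. p ^ multiplicity p (y i))"
    unfolding f_def by (rule prime_part_eq) (use assms y_nz T_prime in auto)
  also have "\<dots> = (\<Prod>p\<in>{p \<in> T. p \<le> max (y i) (y j)}. p ^ multiplicity p (y j))"
    using assms by (intro prod.cong) auto
  also have "\<dots> = f j"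
    unfolding f_def by (rule prime_part_eq[symmetric]) (use assms y_nz T_prime in auto)
  finally show ?thesis .
qed

lemma multiplicity_y_0: "p \<in> T \<Longrightarrow> \<not> per p dvd n \<Longrightarrow> multiplicity p (y n) = 0"
  by (simp add: not_dvd_imp_multiplicity_0 per_dvd_iff)

lemma power_le_f:
  assumes "p \<in> T" "n \<ge> 1" "totient (p ^ B) dvd n"
  shows "p ^ B \<le> f n"
proof (cases "B = 0")
  case False
  have pr: "prime p" "p \<noteq> Suc 0" using T_prime[OF assms(1)] prime_gt_1_nat by auto
  have "[a ^ n = b ^ n] (mod int p ^ B)"
    using power_cong_one[OF assms(1,3)] cong_trans cong_sym by blast
  then have d: "int p ^ B dvd a ^ n - b ^ n" by (simp add: cong_iff_dvd_diff)
  then have B: "B \<le> multiplicity p (y n)"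
    using ne[OF assms(2)] pr by (simp add: multiplicity_y[OF assms(1)] power_dvd_iff_le_multiplicity)
  have "int p dvd a ^ n - b ^ n" using d False by (meson dvd_power dvd_trans not_gr_zero)
  then have mem: "p \<in> {p \<in> T. p dvd y n}" using assms p_dvd_y by simp
  have fin: "finite {p \<in> T. p dvd y n}"
    using finite_periods[OF assms(2)] by (simp add: per_dvd_iff cong: conj_cong)
  have "p ^ B \<le> p ^ multiplicity p (y n)" using B pr by (intro power_increasing) (auto simp: prime_gt_0_nat Suc_le_eq)
  also have "\<dots> dvd f n" unfolding f_def prime_part_def by (rule dvd_prodI[OF fin mem])
  then have "p ^ multiplicity p (y n) \<le> f n" using f_ge[OF assms(2)] by (intro dvd_imp_le) auto
  finally show ?thesis .
qed (use f_ge assms in auto)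

text \<open>If every t were bad, two of them would share the same offset i, making m divide Q times
  their difference. That difference is itself among the bad values, so m would divide an offset
  between 1 and K < m.\<close>

lemma pigeonhole_multiple:
  fixes Q m K :: nat
  assumes "K < m"
  obtains t where "1 \<le> t" "t \<le> Suc K" "\<And>i. 1 \<le> i \<Longrightarrow> i \<le> K \<Longrightarrow> \<not> m dvd Q * t + i"
proof (rule ccontr)
  assume "\<not> thesis"
  then have "\<forall>t\<in>{1..Suc K}. \<exists>i\<in>{1..K}. m dvd Q * t + i" using that by fastforce
  then obtain g where g: "\<And>t. t \<in> {1..Suc K} \<Longrightarrow> g t \<in> {1..K} \<and> m dvd Q * t + g t"
    by metis
  have "g ` {1..Suc K} \<subseteq> {1..K}" using g by blast
  then have "card (g ` {1..Suc K}) \<le> card {1..K}" by (intro card_mono) simp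
  then have "\<not> inj_on g {1..Suc K}" by (intro pigeonhole) simp
  then obtain s' t' where st': "s' \<in> {1..Suc K}" "t' \<in> {1..Suc K}" "s' \<noteq> t'" "g s' = g t'"
    unfolding inj_on_def by blast
  obtain s t where st: "s \<in> {1..Suc K}" "t \<in> {1..Suc K}" "s < t" "g s = g t"
  proof (cases "s' < t'")
    case True
    then show ?thesis using st' that[of s' t'] by simp
  next
    case False
    then show ?thesis using st' that[of t' s'] by simp
  qed
  have "m dvd Q * t + g s" "m dvd Q * s + g s" using g[OF st(1)] g[OF st(2)] st(4) by simp_all
  then have "m dvd (Q * t + g s) - (Q * s + g s)" by (rule dvd_diff_nat)
  then have d: "m dvd Q * (t - s)" by (simp add: diff_mult_distrib2)
  have ts: "t - s \<in> {1..Suc K}" using st by auto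
  then have "m dvd Q * (t - s) + g (t - s)" using g by blast
  then have "m dvd g (t - s)" using d by (simp add: dvd_add_right_iff)
  moreover have "1 \<le> g (t - s)" "g (t - s) \<le> K" using g[OF ts] by auto
  ultimately show False using assms by (auto dest!: dvd_imp_le)
qed

(*
  Take n = Q t with Q a multiple of M l for l < k and, for the finitely many l with M l \<le> K, of
  totient (e l ^ B). The product of the M l with l < k is O(e k), so n + K < M l for l > k. Only M k
  could interfere, and the pigeonhole principle provides a harmless t \<le> K + 1.
*)
lemma repeated_initial_window:
  "\<exists>n\<ge>1. n \<ge> K \<and> 2 ^ s \<le> f n \<and> (\<forall>i. 1 \<le> i \<longrightarrow> i \<le> K \<longrightarrow> f (n + i) = f i)"
proof -
  obtain l1 where l1: "\<And>k l. k \<ge> l1 \<Longrightarrow> l > k \<Longrightarrow> Suc K * e k \<le> M l" using M_growth by blast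
  define l0 where "l0 = Suc l1"
  have Ml0: "K < M l" if "l \<ge> l0" for l
  proof -
    have "Suc K * 1 \<le> Suc K * e l1" using prime_gt_0_nat[OF e_prime] by (intro mult_left_mono) (auto simp: Suc_le_eq)
    also have "\<dots> \<le> M l" using l1[of l1 l] that by (simp add: l0_def)
    finally show ?thesis by simp
  qed
  \<comment> \<open>B exceeds every valuation of the window at the primes \<open>e l\<close> with l
    < l0, and it exceeds s, so that \<open>e 0 ^ B\<close> is at least 2^s.\<close>
  define B where "B = s + 1 + (\<Sum>i\<in>{1..K}. \<Sum>l<l0. multiplicity (e l) (y i))"
  have B: "multiplicity (e l) (y i) < B" if "l < l0" "1 \<le> i" "i \<le> K" for l i
  proof -
    have "multiplicity (e l) (y i) \<le> (\<Sum>l<l0. multiplicity (e l) (y i))"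
      using that by (intro member_le_sum) auto
    also have "\<dots> \<le> (\<Sum>i\<in>{1..K}. \<Sum>l<l0. multiplicity (e l) (y i))"
      using that by (intro member_le_sum[where f = "\<lambda>i. \<Sum>l<l0. multiplicity (e l) (y i)"]) auto
    finally show ?thesis by (simp add: B_def)
  qed
  \<comment> \<open>The factor \<open>Suc K\<close> makes n a multiple of K + 1, hence at least
    K.\<close>
  define Q0 where "Q0 = (\<Prod>l<l0. totient (e l ^ B)) * Suc K"
  have Q0: "Q0 \<ge> 1" using prime_gt_0_nat[OF e_prime] by (simp add: Q0_def Suc_le_eq prod_pos)
  obtain C k2 where C: "\<And>k. k \<ge> k2 \<Longrightarrow> (\<Prod>j<k. e j) \<le> C * e k" using prod_e_bound by blast
  \<comment> \<open>This is the constant that results from bounding \<open>Q * Suc K + K\<close> by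
    a multiple of \<open>e k\<close>.\<close>
  define L where "L = Q0 * C * Suc K + Suc K"
  obtain k3 where k3: "\<And>k l. k \<ge> k3 \<Longrightarrow> l > k \<Longrightarrow> L * e k \<le> M l" using M_growth by blast
  define k where "k = max l0 (max k2 k3)"
  define Q where "Q = Q0 * (\<Prod>l<k. M l)"
  have Q1: "Q \<ge> 1" using Q0 M_ge by (simp add: Q_def Suc_le_eq prod_pos)
  have "(\<Prod>l<k. M l) \<le> (\<Prod>j<k. e j)" using M_less by (intro prod_mono) (auto simp: less_imp_le)
  also have "\<dots> \<le> C * e k" using C by (simp add: k_def)
  finally have Qle: "Q \<le> Q0 * (C * e k)" unfolding Q_def by (rule mult_left_mono) simp
  have M_big: "Q * Suc K + K < M l" if "l > k" for l
  proof -
    have e1: "e k \<ge> 1" using prime_gt_0_nat[OF e_prime, of k] by simp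
    have "Q * Suc K + K < Q * Suc K + Suc K" by simp
    also have "\<dots> \<le> Q0 * (C * e k) * Suc K + Suc K * e k"
    proof -
      have "Suc K \<le> Suc K * e k" using mult_le_mono2[OF e1, of "Suc K"] by (simp only: mult_1_right)
      then show ?thesis by (intro add_mono mult_le_mono1 Qle)
    qed
    also have "\<dots> = L * e k" by (simp add: L_def algebra_simps)
    also have "\<dots> \<le> M l" using k3[of k l] that by (simp add: k_def)
    finally show ?thesis .
  qed
  obtain t where t: "1 \<le> t" "t \<le> Suc K" "\<And>i. 1 \<le> i \<Longrightarrow> i \<le> K \<Longrightarrow> \<not> M k dvd Q * t + i"
    using pigeonhole_multiple[of K "M k" Q] Ml0[of k] by (auto simp: k_def)
  define n where "n = Q * t"
  have n1: "n \<ge> 1" using Q1 t by (simp add: n_def Suc_le_eq)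
  have "Suc K dvd n" unfolding n_def Q_def Q0_def by (intro dvd_mult2 dvd_triv_right)
  then have nK: "n \<ge> K" using n1 by (auto dest!: dvd_imp_le)
  have tot: "totient (e l ^ B) dvd n" if "l < l0" for l
  proof -
    have "totient (e l ^ B) dvd (\<Prod>l<l0. totient (e l ^ B))" using that by (intro dvd_prodI) auto
    then show ?thesis by (simp add: n_def Q_def Q0_def)
  qed
  have Mdvd: "M l dvd n" if "l < k" for l
  proof -
    have "M l dvd (\<Prod>l<k. M l)" using that by (intro dvd_prodI) auto
    then show ?thesis by (simp add: n_def Q_def)
  qed
  have "n \<le> Q * Suc K" unfolding n_def by (rule mult_le_mono2) (rule t(2))
  have "f (n + i) = f i" if i: "1 \<le> i" "i \<le> K" for i
  proof (rule f_cong)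
    fix p assume p: "p \<in> T"
    then obtain l where l: "p = e l" using e_surj by blast
    show "multiplicity p (y (n + i)) = multiplicity p (y i)"
    proof (cases "l < l0")
      case True
      then show ?thesis using multiplicity_y_shift[OF p, of B n i] tot B i l by simp
    next
      case False
      have nd: "\<not> M l dvd i" using Ml0[of l] False i by (auto dest!: dvd_imp_le)
      consider "l < k" | "l = k" | "l > k" by linarith
      then have "\<not> M l dvd n + i"
      proof cases
        case 1
        then show ?thesis using Mdvd nd by (simp add: dvd_add_right_iff)
      next
        case 2
        then show ?thesis using t(3)[OF i] by (simp add: n_def)
      next
        case 3
        have "n + i < M l" using M_big[OF 3] \<open>n \<le> Q * Suc K\<close> i by linarith
        then show ?thesis using i by (auto dest!: dvd_imp_le)
      qed
      then show ?thesis using nd multiplicity_y_0[OF p] by (simp add: l M_def)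
    qed
  qed (use i n1 in auto)
  moreover have "2 ^ s \<le> f n"
  proof -
    have "(2::nat) ^ s \<le> e 0 ^ s" using prime_ge_2_nat[OF e_prime] by (intro power_mono) auto
    also have "\<dots> \<le> e 0 ^ B" using prime_gt_0_nat[OF e_prime] by (intro power_increasing) (auto simp: B_def Suc_le_eq)
    also have "\<dots> \<le> f n" using tot[of 0] n1 by (intro power_le_f e_in) (auto simp: l0_def)
    finally show ?thesis .
  qed
  ultimately show ?thesis using n1 nK by blast
qed

end

section \<open>The natural boundary\<close>

text \<open>Solved for its lowest nonzero term, the recurrence expresses u n through the terms after
  it. These are the values of the fixed initial window, so |u n| equals a constant independent of n,
  although the windows allow it to be arbitrarily large.\<close>

lemma repeated_windows_no_recurrence:
  fixes u :: "nat \<Rightarrow> complex" and P :: "complex poly"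
  assumes windows: "\<And>K s. \<exists>n\<ge>1. n \<ge> K \<and> 2 ^ s \<le> norm (u n) \<and> (\<forall>i. 1 \<le> i \<longrightarrow> i \<le> K \<longrightarrow> u (n + i) = u i)"
    and P: "P \<noteq> 0" and rec: "\<And>j. (\<Sum>i\<le>degree P. coeff P i * u (i + j)) = 0"
  shows False
proof -
  define l where "l = (LEAST l. coeff P l \<noteq> 0)"
  have "coeff P (degree P) \<noteq> 0" using P by simp
  then have l: "coeff P l \<noteq> 0" "l \<le> degree P" and below: "\<And>i. i < l \<Longrightarrow> coeff P i = 0"
    unfolding l_def using LeastI[of "\<lambda>l. coeff P l \<noteq> 0"] Least_le[of "\<lambda>l. coeff P l \<noteq> 0"]
    by (blast dest: not_less_Least)+
  define D where "D = norm (\<Sum>i\<in>{l<..degree P}. coeff P i * u (i - l))"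
  obtain s where s: "D / norm (coeff P l) < 2 ^ s" using real_arch_pow[of 2] by auto
  \<comment> \<open>The recurrence will be used at shift \<open>n - l\<close>;
    \<open>n \<ge> degree P\<close> makes this subtraction exact.\<close>
  obtain n where n: "n \<ge> 1" "n \<ge> degree P" "2 ^ s \<le> norm (u n)"
      "\<And>i. 1 \<le> i \<Longrightarrow> i \<le> degree P \<Longrightarrow> u (n + i) = u i"
    using windows[of "degree P" s] by blast
  have "{..degree P} = {..<l} \<union> ({l} \<union> {l<..degree P})" using l(2) by auto
  then have "(\<Sum>i\<le>degree P. coeff P i * u (i + (n - l))) =
      (\<Sum>i\<in>{..<l} \<union> ({l} \<union> {l<..degree P}). coeff P i * u (i + (n - l)))" by simp
  also have "\<dots> = (\<Sum>i<l. coeff P i * u (i + (n - l))) + (\<Sum>i\<in>{l} \<union> {l<..degree P}. coeff P i * u (i + (n - l)))"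
    by (rule sum.union_disjoint) auto
  also have "(\<Sum>i<l. coeff P i * u (i + (n - l))) = 0" using below by simp
  also have "(\<Sum>i\<in>{l} \<union> {l<..degree P}. coeff P i * u (i + (n - l))) =
      coeff P l * u n + (\<Sum>i\<in>{l<..degree P}. coeff P i * u (i + (n - l)))"
    using l(2) n(2) by simp
  also have "(\<Sum>i\<in>{l<..degree P}. coeff P i * u (i + (n - l))) = (\<Sum>i\<in>{l<..degree P}. coeff P i * u (i - l))"
  proof (rule sum.cong[OF refl])
    fix i assume i: "i \<in> {l<..degree P}"
    have "i + (n - l) = n + (i - l)" using i n(2) l(2) by auto
    moreover have "1 \<le> i - l" "i - l \<le> degree P" using i by auto
    ultimately show "coeff P i * u (i + (n - l)) = coeff P i * u (i - l)" using n(4)[of "i - l"] by simp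
  qed
  finally have "coeff P l * u n + (\<Sum>i\<in>{l<..degree P}. coeff P i * u (i - l)) = 0"
    using rec[of "n - l"] by simp
  then have "coeff P l * u n = - (\<Sum>i\<in>{l<..degree P}. coeff P i * u (i - l))"
    by (simp add: eq_neg_iff_add_eq_0)
  then have "norm (coeff P l * u n) = D" by (simp only: D_def norm_minus_cancel)
  then have "norm (u n) = D / norm (coeff P l)" using l(1) by (simp add: norm_mult field_simps)
  then show False using s n(3) by simp
qed

text \<open>F(R z) is split into B1, carrying the large coefficients, and B2, whose radius exceeds
  1. Since B2 is holomorphic across the circle, B1 inherits the continuation and the gap theorem
  applies to it. Then both radii exceed 1, so F would converge beyond R.\<close>

lemma gaps_in_large_coeffs_no_continuation:
  fixes F :: "complex fps"
  assumes R: "0 < R" "R < 1" "fps_conv_radius F = ereal R"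
    and gaps: "\<And>c::real. c > 1 \<Longrightarrow> \<exists>m\<ge>1. \<exists>n0. \<forall>n\<ge>n0. \<forall>i<n. c ^ n \<le> norm (fps_nth F n) \<longrightarrow>
       n * (m - 1) < i * m \<longrightarrow> norm (fps_nth F i) < c ^ i"
    and U: "open U" "w \<in> U" "norm w = R" "ball 0 R \<subseteq> U" "g holomorphic_on U"
      "\<And>z. z \<in> ball 0 R \<Longrightarrow> g z = eval_fps F z"
  shows False
proof -
  \<comment> \<open>The threshold 1/q is the geometric mean of 1 and 1/R: above 1, as the gap
    hypothesis needs, and below 1/R, so that the small coefficients decay like q^n after
    rescaling.\<close>
  define q where "q = sqrt R"
  have q: "0 < q" "q < 1" "q * q = R" using R by (auto simp: q_def)
  define \<rho> where "\<rho> = 1 / sqrt q"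
  have \<rho>: "\<rho> > 1" "q * \<rho> = sqrt q" using q by (auto simp: \<rho>_def real_div_sqrt)
  define big where "big n \<longleftrightarrow> (1 / q) ^ n \<le> norm (fps_nth F n)" for n
  define B1 where "B1 = Abs_fps (\<lambda>n. if big n then fps_nth F n * of_real R ^ n else 0)"
  define B2 where "B2 = Abs_fps (\<lambda>n. if big n then 0 else fps_nth F n * of_real R ^ n)"
  have F_abs: "summable (\<lambda>n. norm (fps_nth F n * (of_real R * z) ^ n))" if "norm z < 1" for z :: complex
    using abs_summable_in_conv_radius[of "of_real R * z" "fps_nth F"] R that
    by (simp add: fps_conv_radius_def norm_mult)
  have B2_bound: "norm (fps_nth B2 n) \<le> q ^ n" for n
  proof (cases "big n")
    case False
    then have "norm (fps_nth F n) \<le> (1 / q) ^ n" by (simp add: big_def)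
    then have "norm (fps_nth B2 n) \<le> (1 / q) ^ n * R ^ n"
      using False R by (simp add: B2_def norm_mult norm_power mult_right_mono)
    also have "\<dots> = (1 / q * R) ^ n" by (simp only: power_mult_distrib)
    also have "1 / q * R = q" using q by (simp add: field_simps)
    finally show ?thesis .
  qed (use q in \<open>simp add: B2_def\<close>)
  have radius2: "fps_conv_radius B2 \<ge> ereal \<rho>"
  proof -
    have "summable (\<lambda>n. fps_nth B2 n * of_real \<rho> ^ n)"
    proof (rule summable_comparison_test'[where N = 0])
      show "summable (\<lambda>n. sqrt q ^ n)" using q by (intro summable_geometric) auto
      show "norm (fps_nth B2 n * of_real \<rho> ^ n) \<le> sqrt q ^ n" for n
      proof -
        have "norm (fps_nth B2 n * of_real \<rho> ^ n) \<le> q ^ n * \<rho> ^ n"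
          using B2_bound \<rho> by (simp add: norm_mult norm_power mult_right_mono)
        then show ?thesis by (simp only: power_mult_distrib[symmetric] \<rho>(2))
      qed
    qed
    then have "ereal (norm (complex_of_real \<rho>)) \<le> fps_conv_radius B2"
      unfolding fps_conv_radius_def by (rule conv_radius_geI)
    then show ?thesis using \<rho> by simp
  qed
  have B1_norm: "norm (fps_nth B1 n * z ^ n) \<le> norm (fps_nth F n * (of_real R * z) ^ n)" for n z
    by (simp add: B1_def norm_mult norm_power power_mult_distrib)
  have radius1: "fps_conv_radius B1 \<ge> 1"
    unfolding fps_conv_radius_def
  proof (rule conv_radius_geI_ex')
    fix r :: real assume "0 < r" "ereal r < 1"
    then have "norm (complex_of_real r) < 1" by simp
    then show "summable (\<lambda>n. fps_nth B1 n * of_real r ^ n)"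
      using B1_norm by (intro summable_comparison_test'[OF F_abs, where N = 0]) auto
  qed
  have sum_eq: "fps_nth B1 n * z ^ n + fps_nth B2 n * z ^ n = fps_nth F n * (of_real R * z) ^ n" for n z
    by (simp add: B1_def B2_def power_mult_distrib)
  \<comment> \<open>The rescaled domain is cut down to a disc on which B2 is holomorphic.\<close>
  define U' where "U' = (\<lambda>z. of_real R * z) -` U \<inter> ball 0 \<rho>"
  define G where "G z = g (of_real R * z) - eval_fps B2 z" for z
  have ball2: "ball 0 \<rho> \<subseteq> eball 0 (fps_conv_radius B2)"
    using radius2 by (auto simp: eball_def intro: order.strict_trans2[of _ "ereal \<rho>"])
  have "fps_conv_radius B1 > 1"
  proof -
    have "(1 / q) > 1" using q by simp
    then obtain m n0 where m: "m \<ge> 1" and gap: "\<And>n i. n \<ge> n0 \<Longrightarrow> i < n \<Longrightarrow> (1 / q) ^ n \<le> norm (fps_nth F n) \<Longrightarrow>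
       n * (m - 1) < i * m \<Longrightarrow> norm (fps_nth F i) < (1 / q) ^ i"
      using gaps by blast
    show ?thesis
    proof (rule hadamard_gaps_no_continuation[of U' "w / of_real R" G B1 m n0])
      have "open ((\<lambda>z. of_real R * z) -` U)"
        by (rule continuous_open_vimage) (use U in \<open>auto intro: continuous_intros\<close>)
      then show "open U'" by (auto simp: U'_def)
      show "norm (w / of_real R) = 1" using U R by (simp add: norm_divide)
      then show "w / of_real R \<in> U'" using U R \<rho> by (simp add: U'_def)
      show "ball 0 1 \<subseteq> U'"
      proof
        fix z :: complex assume z: "z \<in> ball 0 1"
        then have "of_real R * z \<in> ball 0 R" using R by (simp add: norm_mult)
        then show "z \<in> U'" using z \<rho> U(4) by (auto simp: U'_def)
      qed
      have "(g \<circ> (\<lambda>z. of_real R * z)) holomorphic_on U'"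
        by (rule holomorphic_on_compose_gen[OF _ U(5)]) (auto simp: U'_def intro!: holomorphic_intros)
      moreover have "eval_fps B2 holomorphic_on U'"
        using ball2 by (intro holomorphic_on_eval_fps) (auto simp: U'_def)
      ultimately show "G holomorphic_on U'"
        unfolding G_def[abs_def] o_def by (rule holomorphic_on_diff)
      show "G z = eval_fps B1 z" if z: "z \<in> ball 0 1" for z
      proof -
        have nz: "norm z < 1" using z by simp
        then have "ereal (norm z) < fps_conv_radius B2"
          using \<rho> by (intro order.strict_trans2[OF _ radius2]) simp
        then have s2: "summable (\<lambda>n. fps_nth B2 n * z ^ n)" by (rule summable_fps)
        have "ereal (norm z) < fps_conv_radius B1"
          using nz by (intro order.strict_trans2[OF _ radius1]) simp
        then have s1: "summable (\<lambda>n. fps_nth B1 n * z ^ n)" by (rule summable_fps)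
        have "g (of_real R * z) = eval_fps F (of_real R * z)"
          using nz R by (intro U(6)) (simp add: norm_mult)
        also have "\<dots> = (\<Sum>n. fps_nth B1 n * z ^ n + fps_nth B2 n * z ^ n)"
          by (simp add: eval_fps_def sum_eq)
        also have "\<dots> = eval_fps B1 z + eval_fps B2 z"
          by (simp add: eval_fps_def suminf_add[OF s1 s2])
        finally show ?thesis by (simp add: G_def)
      qed
      show "fps_nth B1 i = 0" if "n \<ge> n0" "fps_nth B1 n \<noteq> 0" "i < n" "n * (m - 1) < i * m" for n i
        using gap[OF that(1,3) _ that(4)] that(2) by (auto simp: B1_def big_def split: if_splits)
    qed (use radius1 m in auto)
  qed
  then have "1 < min (fps_conv_radius B1) (ereal \<rho>)" using \<rho> by simp
  then obtain x where x: "1 < ereal x" "ereal x < min (fps_conv_radius B1) (ereal \<rho>)"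
    using ereal_dense2 by blast
  then have x1: "x > 1" by simp
  have "ereal (norm (complex_of_real x)) < fps_conv_radius B1" "ereal (norm (complex_of_real x)) < fps_conv_radius B2"
    using x x1 radius2 by (auto intro: order.strict_trans2[of _ "ereal \<rho>"])
  then have "summable (\<lambda>n. fps_nth B1 n * of_real x ^ n + fps_nth B2 n * of_real x ^ n)"
    by (intro summable_add summable_fps)
  then have "summable (\<lambda>n. fps_nth F n * (of_real R * of_real x) ^ n)" by (simp only: sum_eq)
  then have "ereal (norm (of_real R * of_real x :: complex)) \<le> fps_conv_radius F"
    unfolding fps_conv_radius_def by (rule conv_radius_geI)
  then show False using R x1 by (simp add: norm_mult)
qed

text \<open>Absolute value 1 makes the multiplicities in numerator and denominator equal, and
  coprimality forces both to be 0.\<close>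

lemma padic_abs_eq_1_imp_not_dvd:
  assumes "prime p" "quotient_of r = (a, b)" "r \<noteq> 0" "padic_abs p r = 1"
  shows "\<not> int p dvd a" "\<not> int p dvd b"
proof -
  have cop: "coprime a b" and b: "b > 0" using assms quotient_of_coprime quotient_of_denom_pos by blast+
  have a: "a \<noteq> 0" using quotient_of_div[OF assms(2)] assms(3) by auto
  have pp: "prime (int p)" using assms by simp
  have p1: "real p > 1" using prime_gt_1_nat[OF assms(1)] by simp
  define k where "k = int (multiplicity (int p) b) - int (multiplicity (int p) a)"
  have eq: "real p powi k = 1" using assms by (simp add: padic_abs_def k_def)
  have "k = 0"
  proof (rule ccontr)
    assume "k \<noteq> 0"
    then consider "k > 0" | "k < 0" by linarith
    then show False
    proof cases
      case 1
      then have "real p ^ nat k > 1" using p1 by (intro one_less_power) auto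
      then show False using eq 1 by (simp add: power_int_def)
    next
      case 2
      then have "real p ^ nat (- k) > 1" using p1 by (intro one_less_power) auto
      then show False using eq 2 by (simp add: power_int_def power_inverse)
    qed
  qed
  then have m: "multiplicity (int p) b = multiplicity (int p) a" by (simp add: k_def)
  have iff: "int p dvd b \<longleftrightarrow> int p dvd a"
    using m a b pp multiplicity_gt_zero_iff[of a "int p"] multiplicity_gt_zero_iff[of b "int p"]
    by (metis less_irrefl not_prime_unit)
  moreover have "\<not> (int p dvd a \<and> int p dvd b)"
    using cop pp by (meson coprime_common_divisor not_prime_unit)
  ultimately show "\<not> int p dvd a" "\<not> int p dvd b" by auto
qed

theorem theorem13:
  fixes r :: rat and S :: "nat set"
  assumes "r \<noteq> 0" and "r \<noteq> 1" and "r \<noteq> -1"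
    and "\<forall>p\<in>S. prime p"
    and "\<forall>p. prime p \<and> p \<notin> S \<longrightarrow> padic_abs p r = 1"
    and "infinite {p. prime p \<and> p \<notin> S}"
    and "filterlim
           (\<lambda>n. ln (real (enumerate {p. prime p \<and> p \<notin> S} (Suc n)))
                / real (enumerate {p. prime p \<and> p \<notin> S} n))
           at_top sequentially"
  shows "\<exists>R. R \<le> 1 \<and> natural_boundary (F_S r S) R"
proof -
  obtain a b where q: "quotient_of r = (a, b)" by (cases "quotient_of r")
  have b: "b > 0" and r: "r = of_int a / of_int b"
    using q quotient_of_denom_pos quotient_of_div by blast+
  define T where "T = {p. prime p \<and> p \<notin> S}"
  \<comment> \<open>Equality would make r a rational root of unity, that is 1 or -1.\<close>
  have ne: "a ^ n \<noteq> b ^ n" if n: "n \<ge> 1" for n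
  proof
    assume "a ^ n = b ^ n"
    then have "of_int a ^ n = (of_int b ^ n :: rat)" by (metis of_int_power)
    then have "r ^ n = 1" using b by (simp add: r power_divide)
    then have "\<bar>r\<bar> ^ n = 1 ^ n" by (metis abs_one power_abs power_one)
    then have "\<bar>r\<bar> = 1" by (rule power_eq_imp_eq_base) (use n in auto)
    then show False using assms(2,3) by auto
  qed
  interpret X: sparse_power_diff a b T
  proof
    show "\<not> int p dvd a" "\<not> int p dvd b" if "p \<in> T" for p
      using padic_abs_eq_1_imp_not_dvd[OF _ q assms(1), of p] that assms(5) by (auto simp: T_def)
  qed (use ne assms in \<open>auto simp: T_def\<close>)
  have f: "f_S r S n = real (X.f n)" if "n \<ge> 1" for n
    unfolding X.f_def X.y_def unfolding T_def
    by (rule f_S_eq_prime_part[OF q that ne[OF that]])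
       (use assms(4,5) padic_abs_eq_1_imp_not_dvd[OF _ q assms(1)] in auto)
  define F where "F = F_S r S"
  \<comment> \<open>The constant coefficient is 0 and not \<open>X.f 0\<close>; accordingly the
    repeated windows start at index 1.\<close>
  have F: "fps_nth F n = (if n = 0 then 0 else of_nat (X.f n))" for n
    by (simp add: F_def F_S_def f)
  have F_norm: "norm (fps_nth F n) = (if n = 0 then 0 else real (X.f n))" for n
    by (simp add: F)
  \<comment> \<open>The coefficients from index 1 on are positive integers, so they do not tend to
    0. The matching positive lower bound for the radius comes from
    \<open>X.f n \<le> X.H ^ n\<close>.\<close>
  have upper: "fps_conv_radius F \<le> 1"
  proof (rule ccontr)
    assume "\<not> fps_conv_radius F \<le> 1"
    then have "summable (\<lambda>n. fps_nth F n * 1 ^ n)" by (intro summable_fps) (simp add: not_le one_ereal_def)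
    then have "(\<lambda>n. norm (fps_nth F n)) \<longlonglongrightarrow> 0" using summable_LIMSEQ_zero tendsto_norm_zero by fastforce
    then have "eventually (\<lambda>n. norm (fps_nth F n) < 1) sequentially"
      by (rule order_tendstoD) simp
    then obtain N where "\<And>n. n \<ge> N \<Longrightarrow> norm (fps_nth F n) < 1" by (auto simp: eventually_sequentially)
    from this[of "Suc N"] X.f_ge[of "Suc N"] show False by (simp add: F_norm)
  qed
  have lower: "fps_conv_radius F > 0"
  proof -
    define x where "x = 1 / (2 * real X.H)"
    have x: "x > 0" "real X.H * x = 1 / 2" using X.H_pos by (auto simp: x_def)
    have "summable (\<lambda>n. fps_nth F n * of_real x ^ n)"
    proof (rule summable_comparison_test'[where N = 0])
      show "summable (\<lambda>n. (1 / 2 :: real) ^ n)" by (intro summable_geometric) auto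
      show "norm (fps_nth F n * of_real x ^ n) \<le> (1 / 2) ^ n" for n
      proof (cases "n = 0")
        case False
        then have "norm (fps_nth F n) \<le> real X.H ^ n"
          using X.f_le[of n] by (simp add: F_norm flip: of_nat_power)
        then have "norm (fps_nth F n * of_real x ^ n) \<le> real X.H ^ n * x ^ n"
          using x by (simp add: norm_mult norm_power mult_right_mono)
        then show ?thesis by (simp only: power_mult_distrib[symmetric] x(2))
      qed (simp add: F)
    qed
    then have "ereal (norm (complex_of_real x)) \<le> fps_conv_radius F"
      unfolding fps_conv_radius_def by (rule conv_radius_geI)
    moreover have "0 < ereal (norm (complex_of_real x))" using x by simp
    ultimately show ?thesis by (rule order.strict_trans2[rotated])
  qed
  obtain R where R: "fps_conv_radius F = ereal R"
    using upper lower by (cases "fps_conv_radius F") auto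
  have R01: "0 < R" "R \<le> 1" using upper lower by (auto simp: R)
  have False if U: "open U" "connected U" "ball 0 R \<subset> U" "g holomorphic_on U"
      "\<forall>z\<in>ball 0 R. g z = eval_fps F z" for U g
  proof -
    have "(0::complex) \<in> ball 0 R" using R01 by simp
    then have "U \<inter> ball 0 R \<noteq> {}" using psubset_imp_subset[OF U(3)] by blast
    moreover have "U - ball 0 R \<noteq> {}" using U(3) by auto
    \<comment> \<open>Connectedness turns an arbitrary larger domain into one point w of the circle
      with g holomorphic around it, which is all that the two cases use.\<close>
    ultimately have "U \<inter> frontier (ball 0 R) \<noteq> {}" using U(2) connected_Int_frontier by blast
    then obtain w where "w \<in> U \<inter> frontier (ball 0 R)" by blast
    then have w: "w \<in> U" "norm w = R" using R01 by (auto simp: frontier_ball)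
    show False
    proof (cases "R = 1")
      case True
      have "fps_nth F i \<in> \<int>" for i by (simp add: F)
      then obtain P where P: "P \<noteq> 0" "\<And>j. (\<Sum>i\<le>degree P. coeff P i * fps_nth F (i + j)) = 0"
        using integer_coeffs_linear_recurrence[of U w g F] U w R True by auto
      show False
      proof (rule repeated_windows_no_recurrence[OF _ P])
        fix K s
        show "\<exists>n\<ge>1. n \<ge> K \<and> 2 ^ s \<le> norm (fps_nth F n) \<and>
            (\<forall>i. 1 \<le> i \<longrightarrow> i \<le> K \<longrightarrow> fps_nth F (n + i) = fps_nth F i)"
        proof -
          obtain n where "n \<ge> 1" "n \<ge> K" "2 ^ s \<le> X.f n" "\<And>i. 1 \<le> i \<Longrightarrow> i \<le> K \<Longrightarrow> X.f (n + i) = X.f i"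
            using X.repeated_initial_window by blast
          moreover from this have "2 ^ s \<le> real (X.f n)" by (metis of_nat_le_iff of_nat_numeral of_nat_power)
          ultimately show ?thesis by (intro exI[of _ n]) (auto simp: F)
        qed
      qed
    next
      case False
      show False
      proof (rule gaps_in_large_coeffs_no_continuation[OF _ _ R _ U(1) w(1) w(2) _ U(4)])
        fix c :: real assume c: "c > 1"
        obtain m n0 where m: "m \<ge> 1" "\<And>n i. n \<ge> n0 \<Longrightarrow> c ^ n \<le> X.f n \<Longrightarrow> i < n \<Longrightarrow> n * (m - 1) < i * m \<Longrightarrow> X.f i < c ^ i"
          using X.large_values_have_gaps[OF c] by blast
        show "\<exists>m\<ge>1. \<exists>n0. \<forall>n\<ge>n0. \<forall>i<n. c ^ n \<le> norm (fps_nth F n) \<longrightarrow>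
           n * (m - 1) < i * m \<longrightarrow> norm (fps_nth F i) < c ^ i"
          using m by (intro exI[of _ m] conjI exI[of _ n0]) (auto simp: F_norm)
      qed (use R01 False U in auto)
    qed
  qed
  then have "natural_boundary F R"
    unfolding natural_boundary_def using R R01 by blast
  then show ?thesis using R01 by (auto simp: F_def)
qed

end
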